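(* Suppose that an almost complex structure $J$ on $\Omega^1A$ satisfies the integrability condition: $\mathrm d\xi\in\Omega^{0,2}A\oplus\Omega^{1,1}A$ for all $\xi\in\Omega^{0,1}A$. Suppose that $x\in\mathrm{Vec}^{1,0}A\otimes\mathrm{Vec}^{1,0}A$ (tensor over $\mathbb C$) obeys $\mathrm{ev}^{\langle2\rangle}(x\otimes k)=0$ for all $k\in\ker(\wedge:\Omega^{1,0}A\otimes_A\Omega^{1,0}A\to\Omega^{2,0}A)$. Then $\varphi(x)\in\mathrm{Vec}^{1,0}A$.
   Context: $A$ is a unital $*$-algebra over $\mathbb C$ with a differential graded algebra $(\Omega A=\oplus_n\Omega^nA,\mathrm d,\wedge)$, $\Omega^0A=A$, $\mathrm d^2=0$, graded Leibniz rule, generated over $A$ by $\Omega^1A$, with $\Omega^1A=A.\mathrm dA$ (no graded commutativity), such that $a.\mathrm db\mapsto\mathrm db^*.a^*$ is a well defined star operation on $\Omega^1A$ extending to all $\Omega^nA$. $\Omega^1A$ is finitely generated projective as a right $A$-module. An almost complex structure is an $A$-bimodule map $J:\Omega^1A\to\Omega^1A$ with $J(\xi^* )=J(\xi)^*$, $J^2=-\mathrm{id}$, such that $J\otimes\mathrm{id}^{\otimes n-1}+\dots+\mathrm{id}^{\otimes n-1}\otimes J$ on $(\Omega^1A)^{\otimes_An}$ descends via $\wedge$ to a well defined map $J:\Omega^nA\to\Omega^nA$ for each $n$. $\Omega^{p,q}A$ ($p,q\ge0$) is the $\mathrm i(p-q)$-eigenspace of $J$ in $\Omega^{p+q}A$,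 so $\Omega^nA=\oplus_{p+q=n}\Omega^{p,q}A$. $\mathrm{Vec}A=\mathrm{Hom}_A(\Omega^1A,A)$ (right module maps), with $(a.v)(\xi)=a\,v(\xi)$, $(v.a)(\xi)=v(a\xi)$, and $J(v)=v\circ J$; $\mathrm{Vec}^{1,0}A$ and $\mathrm{Vec}^{0,1}A$ are the $+\mathrm i$ and $-\mathrm i$ eigenspaces of $J$ on $\mathrm{Vec}A$. $\mathrm{ev}^{\langle2\rangle}(u\otimes v\otimes\xi\otimes\eta)=u(v(\xi).\eta)$. $\mathrm{AntiVec}_2A$ is the set of $x\in\mathrm{Vec}A\otimes_{\mathbb C}\mathrm{Vec}A$ with $\mathrm{ev}^{\langle2\rangle}(x\otimes k)=0$ for all $k\in\ker(\wedge:\Omega^1A\otimes_A\Omega^1A\to\Omega^2A)$ (an $x$ as in the claim belongs to it). $\varphi:\mathrm{AntiVec}_2A\to\mathrm{Vec}A$ is defined (summing over the tensors making up $x$) by $\varphi(u\otimes v)(\xi)=u(\mathrm d(v(\xi)))+\mathrm{ev}^{\langle2\rangle}(u\otimes v\otimes z)$ for $\xi\in\Omega^1A$, where $z\in\Omega^1A\otimes_A\Omega^1A$ is any element with $\wedge z=\mathrm d\xi$ (the choice does not matter). *)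

theory Defs
  imports
    Complex_Main
    "HOL-Library.Function_Algebras"
    "HOL-Algebra.Coset"
    "HOL-Algebra.Generated_Groups"
    "HOL-Algebra.Free_Abelian_Groups"
begin

section \<open>Balanced tensor products\<close>

text \<open>
  The \<open>n\<close>-fold tensor product \<open>M \<otimes>\<^sub>R \<dots> \<otimes>\<^sub>R M\<close> is the free abelian group on the words of length
  \<open>n\<close> over \<open>M\<close> modulo additivity in every slot and \<open>R\<close>-balancedness between neighbouring slots.
  Here \<open>ra\<close> and \<open>la\<close> are the right and left actions of \<open>R\<close> on \<open>M\<close>. The word \<open>[x\<^sub>1, \<dots>, x\<^sub>n]\<close>
  represents \<open>x\<^sub>1 \<otimes> \<dots> \<otimes> x\<^sub>n\<close>, and an element of the tensor product is a coset of formal sums.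
  For \<open>n = 0\<close> this gives the integers rather than \<open>R\<close>; only \<open>n \<ge> 1\<close> is used.
\<close>

definition words :: "'m set \<Rightarrow> nat \<Rightarrow> 'm list set" where
  "words M n = {w. length w = n \<and> set w \<subseteq> M}"

definition tensor_rels ::
  "'m::ab_group_add set \<Rightarrow> 'r set \<Rightarrow> ('m \<Rightarrow> 'r \<Rightarrow> 'm) \<Rightarrow> ('r \<Rightarrow> 'm \<Rightarrow> 'm) \<Rightarrow> nat
    \<Rightarrow> ('m list \<Rightarrow>\<^sub>0 int) set" where
  "tensor_rels M R ra la n =
     {frag_of (p @ [x + y] @ q) - frag_of (p @ [x] @ q) - frag_of (p @ [y] @ q) | p q x y.
        set p \<subseteq> M \<and> set q \<subseteq> M \<and> x \<in> M \<and> y \<in> M \<and> length p + 1 + length q = n} \<union>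
     {frag_of (p @ [ra x r, y] @ q) - frag_of (p @ [x, la r y] @ q) | p q x y r.
        set p \<subseteq> M \<and> set q \<subseteq> M \<and> x \<in> M \<and> y \<in> M \<and> r \<in> R \<and> length p + 2 + length q = n}"

definition tensor_null ::
  "'m::ab_group_add set \<Rightarrow> 'r set \<Rightarrow> ('m \<Rightarrow> 'r \<Rightarrow> 'm) \<Rightarrow> ('r \<Rightarrow> 'm \<Rightarrow> 'm) \<Rightarrow> nat
    \<Rightarrow> ('m list \<Rightarrow>\<^sub>0 int) set" where
  "tensor_null M R ra la n = generate (free_Abelian_group (words M n)) (tensor_rels M R ra la n)"

definition tensor_power ::
  "'m::ab_group_add set \<Rightarrow> 'r set \<Rightarrow> ('m \<Rightarrow> 'r \<Rightarrow> 'm) \<Rightarrow> ('r \<Rightarrow> 'm \<Rightarrow> 'm) \<Rightarrow> nat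
    \<Rightarrow> ('m list \<Rightarrow>\<^sub>0 int) set monoid" where
  "tensor_power M R ra la n = free_Abelian_group (words M n) Mod tensor_null M R ra la n"

text \<open>
  For \<open>N \<subseteq> M\<close>, \<open>tensor_incl M R ra la n\<close> is the canonical map from the tensor power of \<open>N\<close> to
  that of \<open>M\<close>, which sends the coset of a formal sum to its coset for the relations of \<open>M\<close>.
\<close>

definition tensor_incl ::
  "'m::ab_group_add set \<Rightarrow> 'r set \<Rightarrow> ('m \<Rightarrow> 'r \<Rightarrow> 'm) \<Rightarrow> ('r \<Rightarrow> 'm \<Rightarrow> 'm) \<Rightarrow> nat
    \<Rightarrow> ('m list \<Rightarrow>\<^sub>0 int) set \<Rightarrow> ('m list \<Rightarrow>\<^sub>0 int) set" where
  "tensor_incl M R ra la n X = tensor_null M R ra la n <#>\<^bsub>free_Abelian_group (words M n)\<^esub> X"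


section \<open>Modules\<close>

definition right_module_hom ::
  "'r set \<Rightarrow> 'm::ab_group_add set \<Rightarrow> ('m \<Rightarrow> 'r \<Rightarrow> 'm) \<Rightarrow> 'n::ab_group_add set \<Rightarrow> ('n \<Rightarrow> 'r \<Rightarrow> 'n)
    \<Rightarrow> ('m \<Rightarrow> 'n) \<Rightarrow> bool" where
  "right_module_hom R M ra N rb f \<longleftrightarrow>
     f \<in> M \<rightarrow> N \<and>
     (\<forall>x\<in>M. \<forall>y\<in>M. f (x + y) = f x + f y) \<and>
     (\<forall>x\<in>M. \<forall>r\<in>R. f (ra x r) = rb (f x) r)"

text \<open>\<open>M\<close> is a direct summand of the free right module \<open>A\<^sup>n\<close> for some \<open>n\<close>. Vectors in \<open>A\<^sup>n\<close> are
  sequences that vanish from index \<open>n\<close> on.\<close>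

definition fin_gen_projective_right ::
  "'w::ring set \<Rightarrow> 'w set \<Rightarrow> bool" where
  "fin_gen_projective_right A M \<longleftrightarrow>
     (\<exists>n i p. let F = {f :: nat \<Rightarrow> 'w. (\<forall>k<n. f k \<in> A) \<and> (\<forall>k\<ge>n. f k = 0)};
                  act = (\<lambda>f a k. f k * a)
              in right_module_hom A M (*) F act i \<and>
                 right_module_hom A F act M (*) p \<and>
                 (\<forall>x\<in>M. p (i x) = x))"


section \<open>Star differential graded algebras\<close>

text \<open>
  The whole algebra of forms is a type, with \<open>\<and>\<close> written as \<open>*\<close>; \<open>Form G n\<close> is the
  space of \<open>n\<close>-forms and \<open>Form G 0\<close> is the coordinate algebra \<open>A\<close>. The sort
  \<open>{ring, monoid_mult}\<close> is that of unital rings without \<open>0 \<noteq> 1\<close>.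
\<close>

record 'w form_data =
  scaleC :: "complex \<Rightarrow> 'w \<Rightarrow> 'w"
  Form :: "nat \<Rightarrow> 'w set"
  der :: "'w \<Rightarrow> 'w"
  star :: "'w \<Rightarrow> 'w"

locale star_dga =
  fixes G :: "'w::{ring, monoid_mult} form_data"
  assumes scaleC: "vector_space (scaleC G)"
    and scaleC_mult_left: "scaleC G c (x * y) = scaleC G c x * y"
    and scaleC_mult_right: "scaleC G c (x * y) = x * scaleC G c y"
    and Form_subspace: "module.subspace (scaleC G) (Form G n)"
    and Form_direct_sum:
      "\<exists>!f. finite {n. f n \<noteq> 0} \<and> (\<forall>n. f n \<in> Form G n) \<and> x = (\<Sum>n | f n \<noteq> 0. f n)"
    and Form_one: "1 \<in> Form G 0"
    and Form_mult: "\<lbrakk>x \<in> Form G m; y \<in> Form G n\<rbrakk> \<Longrightarrow> x * y \<in> Form G (m + n)"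
    and der_linear: "Vector_Spaces.linear (scaleC G) (scaleC G) (der G)"
    and der_Form: "x \<in> Form G n \<Longrightarrow> der G x \<in> Form G (Suc n)"
    and der_der: "der G (der G x) = 0"
    and der_Leibniz:
      "x \<in> Form G n \<Longrightarrow> der G (x * y) = der G x * y + (- 1) ^ n * (x * der G y)"
    and Form_1_generated:
      "Form G 1 = module.span (scaleC G) {a * der G b | a b. a \<in> Form G 0 \<and> b \<in> Form G 0}"
    and Form_generated:
      "n \<ge> 1 \<Longrightarrow> Form G n = module.span (scaleC G) (prod_list ` words (Form G 1) n)"
    and star_add: "star G (x + y) = star G x + star G y"
    and star_scaleC: "star G (scaleC G c x) = scaleC G (cnj c) (star G x)"
    and star_star: "star G (star G x) = x"
    and star_Form: "x \<in> Form G n \<Longrightarrow> star G x \<in> Form G n"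
    and star_mult:
      "\<lbrakk>x \<in> Form G m; y \<in> Form G n\<rbrakk> \<Longrightarrow> star G (x * y) = (- 1) ^ (m * n) * (star G y * star G x)"
    and star_mult_der:
      "\<lbrakk>a \<in> Form G 0; b \<in> Form G 0\<rbrakk> \<Longrightarrow> star G (a * der G b) = der G (star G b) * star G a"

text \<open>Evaluation of a formal sum of words under a function on words.\<close>

definition word_sum :: "'w::ring form_data \<Rightarrow> ('l \<Rightarrow> 'w) \<Rightarrow> ('l \<Rightarrow>\<^sub>0 int) \<Rightarrow> 'w" where
  "word_sum G f t =
     (\<Sum>l\<in>Poly_Mapping.keys t. scaleC G (of_int (Poly_Mapping.lookup t l)) (f l))"

text \<open>
  \<open>form_tensor G M n\<close> is \<open>M \<otimes>\<^sub>A \<dots> \<otimes>\<^sub>A M\<close>. As for the homomorphisms induced on factor groups in the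
  library, a map on a tensor product is the common value on the representatives in the coset.
\<close>

definition form_tensor ::
  "'w::ring form_data \<Rightarrow> 'w set \<Rightarrow> nat \<Rightarrow> ('w list \<Rightarrow>\<^sub>0 int) set monoid" where
  "form_tensor G M n = tensor_power M (Form G 0) (*) (*) n"

definition form_tensor_incl ::
  "'w::ring form_data \<Rightarrow> nat \<Rightarrow> ('w list \<Rightarrow>\<^sub>0 int) set \<Rightarrow> ('w list \<Rightarrow>\<^sub>0 int) set" where
  "form_tensor_incl G n = tensor_incl (Form G 1) (Form G 0) (*) (*) n"

definition wedge :: "'w::{ring, monoid_mult} form_data \<Rightarrow> ('w list \<Rightarrow>\<^sub>0 int) set \<Rightarrow> 'w" where
  "wedge G X = the_elem (word_sum G prod_list ` X)"


section \<open>Almost complex structures\<close>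

text \<open>The map \<open>J \<otimes> id \<otimes> \<dots> \<otimes> id + \<dots> + id \<otimes> \<dots> \<otimes> id \<otimes> J\<close> on the \<open>n\<close>-fold tensor power of the
  one-forms.\<close>

definition J_tensor ::
  "'w::ring form_data \<Rightarrow> ('w \<Rightarrow> 'w) \<Rightarrow> nat \<Rightarrow> ('w list \<Rightarrow>\<^sub>0 int) set
    \<Rightarrow> ('w list \<Rightarrow>\<^sub>0 int) set" where
  "J_tensor G J n X =
     the_elem ((\<lambda>t. tensor_null (Form G 1) (Form G 0) (*) (*) n
                      #>\<^bsub>free_Abelian_group (words (Form G 1) n)\<^esub>
                    frag_extend (\<lambda>w. \<Sum>i<length w. frag_of (w[i := J (w ! i)])) t) ` X)"

locale almost_complex = star_dga G for G :: "'w::{ring, monoid_mult} form_data" +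
  fixes J :: "'w \<Rightarrow> 'w"
  assumes J_Form: "\<xi> \<in> Form G 1 \<Longrightarrow> J \<xi> \<in> Form G 1"
    and J_add: "\<lbrakk>\<xi> \<in> Form G 1; \<eta> \<in> Form G 1\<rbrakk> \<Longrightarrow> J (\<xi> + \<eta>) = J \<xi> + J \<eta>"
    and J_left: "\<lbrakk>a \<in> Form G 0; \<xi> \<in> Form G 1\<rbrakk> \<Longrightarrow> J (a * \<xi>) = a * J \<xi>"
    and J_right: "\<lbrakk>a \<in> Form G 0; \<xi> \<in> Form G 1\<rbrakk> \<Longrightarrow> J (\<xi> * a) = J \<xi> * a"
    and J_star: "\<xi> \<in> Form G 1 \<Longrightarrow> J (star G \<xi>) = star G (J \<xi>)"
    and J_J: "\<xi> \<in> Form G 1 \<Longrightarrow> J (J \<xi>) = - \<xi>"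
    and J_descends:
      "\<lbrakk>n \<ge> 1; X \<in> carrier (form_tensor G (Form G 1) n); Y \<in> carrier (form_tensor G (Form G 1) n);
        wedge G X = wedge G Y\<rbrakk> \<Longrightarrow> wedge G (J_tensor G J n X) = wedge G (J_tensor G J n Y)"

text \<open>The descended map on \<open>n\<close>-forms; on \<open>A\<close> it is the empty sum, so that \<open>\<Omega>\<^bsup>0,0\<^esup>A = A\<close>.\<close>

definition J_form :: "'w::{ring, monoid_mult} form_data \<Rightarrow> ('w \<Rightarrow> 'w) \<Rightarrow> nat \<Rightarrow> 'w \<Rightarrow> 'w" where
  "J_form G J n \<omega> =
     (if n = 0 then 0
      else the_elem {wedge G (J_tensor G J n X) | X.
             X \<in> carrier (form_tensor G (Form G 1) n) \<and> wedge G X = \<omega>})"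

definition bigraded :: "'w::{ring, monoid_mult} form_data \<Rightarrow> ('w \<Rightarrow> 'w) \<Rightarrow> nat \<Rightarrow> nat \<Rightarrow> 'w set" where
  "bigraded G J p q =
     {\<omega> \<in> Form G (p + q). J_form G J (p + q) \<omega> = scaleC G (\<i> * (of_nat p - of_nat q)) \<omega>}"

definition integrable_structure :: "'w::{ring, monoid_mult} form_data \<Rightarrow> ('w \<Rightarrow> 'w) \<Rightarrow> bool" where
  "integrable_structure G J \<longleftrightarrow>
     (\<forall>\<xi>\<in>bigraded G J 0 1. der G \<xi> \<in> {\<alpha> + \<beta> | \<alpha> \<beta>. \<alpha> \<in> bigraded G J 0 2 \<and> \<beta> \<in> bigraded G J 1 1})"


section \<open>Vector fields\<close>

text \<open>Vector fields are extended by \<open>0\<close> outside the one-forms, which makes them an additive subgroup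
  of the function type.\<close>

definition Vec :: "'w::ring form_data \<Rightarrow> ('w \<Rightarrow> 'w) set" where
  "Vec G = {v. right_module_hom (Form G 0) (Form G 1) (*) (Form G 0) (*) v \<and>
               (\<forall>\<xi>. \<xi> \<notin> Form G 1 \<longrightarrow> v \<xi> = 0)}"

definition J_Vec :: "'w::ring form_data \<Rightarrow> ('w \<Rightarrow> 'w) \<Rightarrow> ('w \<Rightarrow> 'w) \<Rightarrow> 'w \<Rightarrow> 'w" where
  "J_Vec G J v = (\<lambda>\<xi>. if \<xi> \<in> Form G 1 then v (J \<xi>) else 0)"

definition scale_Vec :: "'w form_data \<Rightarrow> complex \<Rightarrow> ('w \<Rightarrow> 'w) \<Rightarrow> 'w \<Rightarrow> 'w" where
  "scale_Vec G c v = (\<lambda>\<xi>. scaleC G c (v \<xi>))"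

definition Vec10 :: "'w::ring form_data \<Rightarrow> ('w \<Rightarrow> 'w) \<Rightarrow> ('w \<Rightarrow> 'w) set" where
  "Vec10 G J = {v \<in> Vec G. J_Vec G J v = scale_Vec G \<i> v}"

text \<open>\<open>V \<otimes> V\<close> over the complex numbers, for a space \<open>V\<close> of vector fields.\<close>

definition vec_tensor ::
  "'w::ring form_data \<Rightarrow> ('w \<Rightarrow> 'w) set \<Rightarrow> (('w \<Rightarrow> 'w) list \<Rightarrow>\<^sub>0 int) set monoid" where
  "vec_tensor G V = tensor_power V UNIV (\<lambda>v c. scale_Vec G c v) (scale_Vec G) 2"

definition vec_tensor_incl ::
  "'w::ring form_data \<Rightarrow> (('w \<Rightarrow> 'w) list \<Rightarrow>\<^sub>0 int) set \<Rightarrow> (('w \<Rightarrow> 'w) list \<Rightarrow>\<^sub>0 int) set" where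
  "vec_tensor_incl G = tensor_incl (Vec G) UNIV (\<lambda>v c. scale_Vec G c v) (scale_Vec G) 2"

text \<open>On representatives, \<open>(u \<otimes> v) \<otimes> (\<xi> \<otimes> \<eta>)\<close> is sent to \<open>u (v \<xi> * \<eta>)\<close>.\<close>

definition ev2 ::
  "'w::ring form_data \<Rightarrow> (('w \<Rightarrow> 'w) list \<Rightarrow>\<^sub>0 int) set \<Rightarrow> ('w list \<Rightarrow>\<^sub>0 int) set \<Rightarrow> 'w" where
  "ev2 G x k =
     the_elem ((\<lambda>(s, t). word_sum G (\<lambda>us. word_sum G (\<lambda>\<xi>s.
                  (us ! 0) ((us ! 1) (\<xi>s ! 0) * \<xi>s ! 1)) t) s) ` (x \<times> k))"

definition AntiVec2 :: "'w::{ring, monoid_mult} form_data \<Rightarrow> (('w \<Rightarrow> 'w) list \<Rightarrow>\<^sub>0 int) set set" where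
  "AntiVec2 G = {x \<in> carrier (vec_tensor G (Vec G)).
     \<forall>k \<in> carrier (form_tensor G (Form G 1) 2). wedge G k = 0 \<longrightarrow> ev2 G x k = 0}"

text \<open>On \<open>u \<otimes> v\<close> this is \<open>\<xi> \<mapsto> u (d (v \<xi>)) + ev2 (u \<otimes> v) z\<close>, the common value over all \<open>z\<close>
  with \<open>wedge z = d \<xi>\<close>.\<close>

definition phi ::
  "'w::{ring, monoid_mult} form_data \<Rightarrow> (('w \<Rightarrow> 'w) list \<Rightarrow>\<^sub>0 int) set \<Rightarrow> 'w \<Rightarrow> 'w" where
  "phi G = (\<lambda>x\<in>AntiVec2 G. \<lambda>\<xi>.
     if \<xi> \<in> Form G 1
     then the_elem {the_elem (word_sum G (\<lambda>us. (us ! 0) (der G ((us ! 1) \<xi>))) ` x) + ev2 G x z | z.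
                      z \<in> carrier (form_tensor G (Form G 1) 2) \<and> wedge G z = der G \<xi>}
     else 0)"

end

theory Submission
  imports Defs
begin

text \<open>
  The projection of \<open>\<Omega>\<^sup>1 \<otimes> \<Omega>\<^sup>1\<close> onto its (1,0)\<open>\<otimes>\<close>(1,0) part is a polynomial in
  \<open>J \<otimes> id + id \<otimes> J\<close>. Since the latter descends along \<open>\<and>\<close>, the projection preserves
  \<open>ker \<and>\<close>; and \<open>x\<close>, being built from (1,0) vector fields, pairs with \<open>z\<close> and with the projection
  of \<open>z\<close> in the same way. So \<open>x\<close> annihilates all of \<open>ker \<and>\<close>, and the Leibniz rule makes
  \<open>\<phi>(x)\<close> right linear. For \<open>\<xi>\<close> of type (0,1) every \<open>v(\<xi>)\<close> vanishes, and by integrability the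
  projection of a lift \<open>z\<close> of \<open>d\<xi>\<close> lies in \<open>ker \<and>\<close>. Hence \<open>\<phi>(x)(\<xi>) = 0\<close>.
\<close>

text \<open>Keeps \<open>Form G 1\<close> in this shape, which the rewriting
  \<open>1 = Suc 0\<close> would destroy.\<close>

declare One_nat_def [simp del]

section \<open>Classes in a tensor power\<close>

definition tensor_class ::
  "'m::ab_group_add set \<Rightarrow> 'r set \<Rightarrow> ('m \<Rightarrow> 'r \<Rightarrow> 'm) \<Rightarrow> ('r \<Rightarrow> 'm \<Rightarrow> 'm) \<Rightarrow> nat
    \<Rightarrow> ('m list \<Rightarrow>\<^sub>0 int) \<Rightarrow> ('m list \<Rightarrow>\<^sub>0 int) set" where
  "tensor_class M R ra la n t =
     tensor_null M R ra la n #>\<^bsub>free_Abelian_group (words M n)\<^esub> t"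

lemma carrier_tensor_power_iff:
  "X \<in> carrier (tensor_power M R ra la n) \<longleftrightarrow>
     (\<exists>t. Poly_Mapping.keys t \<subseteq> words M n \<and> X = tensor_class M R ra la n t)"
  by (auto simp: tensor_power_def FactGroup_def RCOSETS_def tensor_class_def
      free_Abelian_group_def)

lemma mem_tensor_class:
  "t' \<in> tensor_class M R ra la n t \<longleftrightarrow> t' - t \<in> tensor_null M R ra la n"
  by (force simp: tensor_class_def r_coset_def free_Abelian_group_def)

lemma words_1: "w \<in> words M 1 \<longleftrightarrow> (\<exists>x\<in>M. w = [x])"
  by (auto simp: words_def length_Suc_conv One_nat_def)

lemma words_2: "w \<in> words M 2 \<longleftrightarrow> (\<exists>x\<in>M. \<exists>y\<in>M. w = [x, y])"
  by (auto simp: words_def length_Suc_conv numeral_2_eq_2)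

lemma keys_words_2E:
  assumes "w \<in> Poly_Mapping.keys t" "Poly_Mapping.keys t \<subseteq> words M 2"
  obtains x y where "x \<in> M" "y \<in> M" "w = [x, y]"
  using assms words_2[of w M] by blast

section \<open>Defining relations in lengths one and two\<close>

lemma tensor_rels_1:
  "tensor_rels M R ra la 1 =
     {frag_of [x + y] - frag_of [x] - frag_of [y] | x y. x \<in> M \<and> y \<in> M}"
  by (auto simp: tensor_rels_def One_nat_def)

lemma tensor_rels_cases:
  assumes "r \<in> tensor_rels M R ra la n"
  obtains (add) p q x y where "set p \<subseteq> M" "set q \<subseteq> M" "x \<in> M" "y \<in> M"
      "length p + 1 + length q = n"
      "r = frag_of (p @ [x + y] @ q) - frag_of (p @ [x] @ q) - frag_of (p @ [y] @ q)"
    | (balance) p q x y a where "set p \<subseteq> M" "set q \<subseteq> M" "x \<in> M" "y \<in> M" "a \<in> R"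
      "length p + 2 + length q = n"
      "r = frag_of (p @ [ra x a, y] @ q) - frag_of (p @ [x, la a y] @ q)"
  using assms unfolding tensor_rels_def by blast

text \<open>In length two, the prefix and suffix around an additive slot hold one letter between
  them, which leaves two cases; around a balanced pair both are empty.\<close>

lemma tensor_rels_2_cases:
  assumes "r \<in> tensor_rels M R ra la 2"
  obtains (left) x y z where "x \<in> M" "y \<in> M" "z \<in> M"
      "r = frag_of [x + y, z] - frag_of [x, z] - frag_of [y, z]"
    | (right) x y z where "x \<in> M" "y \<in> M" "z \<in> M"
      "r = frag_of [z, x + y] - frag_of [z, x] - frag_of [z, y]"
    | (balance) x y a where "x \<in> M" "y \<in> M" "a \<in> R"
      "r = frag_of [ra x a, y] - frag_of [x, la a y]"
proof -
  consider (add) p q x y where "set p \<subseteq> M" "set q \<subseteq> M" "x \<in> M" "y \<in> M" "length p + length q = 1"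
      "r = frag_of (p @ [x + y] @ q) - frag_of (p @ [x] @ q) - frag_of (p @ [y] @ q)"
    | (bal) x y a where "x \<in> M" "y \<in> M" "a \<in> R"
      "r = frag_of [ra x a, y] - frag_of [x, la a y]"
    using assms unfolding tensor_rels_def by fastforce
  then show thesis
  proof cases
    case add
    then consider z where "p = []" "q = [z]" | z where "p = [z]" "q = []"
      by (auto simp: add_is_1 length_Suc_conv One_nat_def)
    then show thesis
      using add left right by cases auto
  qed (use balance in blast)
qed

lemma tensor_rels_left:
  "\<lbrakk>x \<in> M; y \<in> M; z \<in> M\<rbrakk>
    \<Longrightarrow> frag_of [x + y, z] - frag_of [x, z] - frag_of [y, z] \<in> tensor_rels M R ra la 2"
  unfolding tensor_rels_def
  by (rule UnI1, rule CollectI, rule exI[of _ "[]"], rule exI[of _ "[z]"]) auto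

lemma tensor_rels_right:
  "\<lbrakk>x \<in> M; y \<in> M; z \<in> M\<rbrakk>
    \<Longrightarrow> frag_of [z, x + y] - frag_of [z, x] - frag_of [z, y] \<in> tensor_rels M R ra la 2"
  unfolding tensor_rels_def
  by (rule UnI1, rule CollectI, rule exI[of _ "[z]"], rule exI[of _ "[]"]) auto

lemma tensor_rels_balance:
  "\<lbrakk>x \<in> M; y \<in> M; a \<in> R\<rbrakk>
    \<Longrightarrow> frag_of [ra x a, y] - frag_of [x, la a y] \<in> tensor_rels M R ra la 2"
  unfolding tensor_rels_def
  by (rule UnI2, rule CollectI, rule exI[of _ "[]"], rule exI[of _ "[]"]) auto

section \<open>The subgroup of relations and its cosets\<close>

locale tensor_module =
  fixes M :: "'m::ab_group_add set" and R :: "'r set"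
    and ra :: "'m \<Rightarrow> 'r \<Rightarrow> 'm" and la :: "'r \<Rightarrow> 'm \<Rightarrow> 'm"
  assumes add_closed: "\<lbrakk>x \<in> M; y \<in> M\<rbrakk> \<Longrightarrow> x + y \<in> M"
    and ra_closed: "\<lbrakk>x \<in> M; r \<in> R\<rbrakk> \<Longrightarrow> ra x r \<in> M"
    and la_closed: "\<lbrakk>x \<in> M; r \<in> R\<rbrakk> \<Longrightarrow> la r x \<in> M"
begin

text \<open>Closure under addition and both actions keeps every word in a relation over
  \<open>M\<close>, so the relations generate a subgroup of the free abelian group.\<close>

lemma tensor_rels_carrier:
  assumes "r \<in> tensor_rels M R ra la n"
  shows "r \<in> carrier (free_Abelian_group (words M n))"
proof -
  have of: "frag_of w \<in> carrier (free_Abelian_group (words M n))"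
    if "length w = n" "set w \<subseteq> M" for w
    using that by (simp add: words_def)
  have diff: "a - b \<in> carrier (free_Abelian_group (words M n))"
    if "a \<in> carrier (free_Abelian_group (words M n))"
      "b \<in> carrier (free_Abelian_group (words M n))" for a b
    using that keys_diff[of a b] by auto
  show ?thesis
    using assms
  proof (cases rule: tensor_rels_cases)
    case add
    show ?thesis
      unfolding add(6) using add add_closed by (intro diff of) auto
  next
    case balance
    show ?thesis
      unfolding balance(7) using balance ra_closed la_closed by (intro diff of) auto
  qed
qed

lemma subgroup_tensor_null:
  "subgroup (tensor_null M R ra la n) (free_Abelian_group (words M n))"
  unfolding tensor_null_def
  using tensor_rels_carrier by (intro group.generate_is_subgroup) (simp, blast)

lemma tensor_null_keys:
  "t \<in> tensor_null M R ra la n \<Longrightarrow> Poly_Mapping.keys t \<subseteq> words M n"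
  using subgroup.mem_carrier[OF subgroup_tensor_null] by simp

lemma tensor_null_0: "0 \<in> tensor_null M R ra la n"
  using subgroup.one_closed[OF subgroup_tensor_null] by simp

lemma tensor_null_add:
  "\<lbrakk>s \<in> tensor_null M R ra la n; t \<in> tensor_null M R ra la n\<rbrakk> \<Longrightarrow> s + t \<in> tensor_null M R ra la n"
  using subgroup.m_closed[OF subgroup_tensor_null] by simp

lemma tensor_null_uminus:
  "t \<in> tensor_null M R ra la n \<Longrightarrow> - t \<in> tensor_null M R ra la n"
  using subgroup.m_inv_closed[OF subgroup_tensor_null] tensor_null_keys by fastforce

lemma tensor_null_rel:
  "t \<in> tensor_rels M R ra la n \<Longrightarrow> t \<in> tensor_null M R ra la n"
  unfolding tensor_null_def by (rule generate.incl)

lemma tensor_class_keys: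
  assumes "Poly_Mapping.keys t \<subseteq> words M n" "t' \<in> tensor_class M R ra la n t"
  shows "Poly_Mapping.keys t' \<subseteq> words M n"
  using assms tensor_null_keys[of "t' - t" n] Poly_Mapping.keys_add[of "t' - t" t]
  by (auto simp: mem_tensor_class)

lemma tensor_class_refl: "t \<in> tensor_class M R ra la n t"
  by (simp add: mem_tensor_class tensor_null_0)

lemma tensor_class_eqI:
  assumes "t' - t \<in> tensor_null M R ra la n"
  shows "tensor_class M R ra la n t' = tensor_class M R ra la n t"
proof -
  have "s - t \<in> tensor_null M R ra la n" if "s - t' \<in> tensor_null M R ra la n" for s
    using tensor_null_add[OF that assms] by simp
  moreover have "s - t' \<in> tensor_null M R ra la n" if "s - t \<in> tensor_null M R ra la n" for s
    using tensor_null_add[OF that tensor_null_uminus[OF assms]] by simp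
  ultimately show ?thesis
    by (auto simp: mem_tensor_class)
qed

text \<open>Induction over the generated subgroup; compatibility with differences already gives
  zero, negatives and sums. With \<open>K = {0}\<close> this shows that a value depends only on the
  class, and with \<open>K\<close> a subgroup of relations that a map of formal sums descends to
  classes.\<close>

lemma tensor_null_image:
  fixes f :: "('m list \<Rightarrow>\<^sub>0 int) \<Rightarrow> 'b::ab_group_add"
  assumes t: "t \<in> tensor_null M R ra la n"
    and diff: "\<And>a b. f (a - b) = f a - f b"
    and rel: "\<And>r. r \<in> tensor_rels M R ra la n \<Longrightarrow> f r \<in> K"
    and K: "0 \<in> K" "\<And>x y. \<lbrakk>x \<in> K; y \<in> K\<rbrakk> \<Longrightarrow> x + y \<in> K" "\<And>x. x \<in> K \<Longrightarrow> - x \<in> K"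
  shows "f t \<in> K"
proof -
  have f0: "f 0 = 0"
    using diff[of 0 0] by simp
  have minus: "f (- a) = - f a" for a
    using diff[of 0 a] f0 by simp
  have add: "f (a + b) = f a + f b" for a b
    using diff[of a "- b"] minus by simp
  show ?thesis
    using t unfolding tensor_null_def
  proof (induction rule: generate.induct)
    case one
    then show ?case using f0 K by simp
  next
    case (incl h)
    then show ?case using rel by simp
  next
    case (inv h)
    then have "Poly_Mapping.keys h \<subseteq> words M n"
      using tensor_rels_carrier by fastforce
    then show ?case using inv rel K minus by simp
  next
    case (eng h1 h2)
    then show ?case using add K by simp
  qed
qed

text \<open>Maps on tensor powers are defined as \<open>the_elem\<close> of the image of a coset, so
  they can be computed on one representative once they are constant on the coset.\<close>

lemma image_tensor_class:
  assumes "\<And>s. s \<in> tensor_class M R ra la n t \<Longrightarrow> f s = f t"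
  shows "f ` tensor_class M R ra la n t = {f t}"
  using assms tensor_class_refl[of t n] by blast

text \<open>Relations over \<open>N\<close> are relations over \<open>M\<close>, so adding all
  relations over \<open>M\<close> to the smaller coset of \<open>t\<close> fills up exactly the
  larger one.\<close>

lemma tensor_incl_class:
  assumes "tensor_module N R ra la" "N \<subseteq> M"
  shows "tensor_incl M R ra la n (tensor_class N R ra la n t) = tensor_class M R ra la n t"
proof -
  interpret N: tensor_module N R ra la by fact
  have sub: "s \<in> tensor_null M R ra la n" if "s \<in> tensor_null N R ra la n" for s
  proof (rule N.tensor_null_image[OF that, of "\<lambda>s. s"])
    fix r assume "r \<in> tensor_rels N R ra la n"
    then have "r \<in> tensor_rels M R ra la n"
      using assms(2) unfolding tensor_rels_def by blast
    then show "r \<in> tensor_null M R ra la n"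
      by (rule tensor_null_rel)
  qed (simp_all add: tensor_null_0 tensor_null_add tensor_null_uminus)
  have "r + s - t \<in> tensor_null M R ra la n"
    if "r \<in> tensor_null M R ra la n" "s - t \<in> tensor_null N R ra la n" for r s
    using tensor_null_add[OF that(1) sub[OF that(2)]] by (simp add: add_diff_eq)
  moreover have "\<exists>r\<in>tensor_null M R ra la n. \<exists>u. u - t \<in> tensor_null N R ra la n \<and> s = r + u"
    if "s - t \<in> tensor_null M R ra la n" for s
    using that N.tensor_null_0 by (intro bexI[of _ "s - t"] exI[of _ t]) auto
  ultimately show ?thesis
    by (fastforce simp: tensor_incl_def set_mult_def mem_tensor_class)
qed

end


section \<open>Evaluation of formal sums\<close>

context star_dga
begin

interpretation vs: vector_space "scaleC G"
  by (rule scaleC)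

text \<open>Cancellation can make the keys of a difference smaller than the union of the keys; a
  common finite index set lets the sums be compared term by term.\<close>

lemma word_sum_superset:
  assumes "finite K" "Poly_Mapping.keys t \<subseteq> K"
  shows "word_sum G f t = (\<Sum>l\<in>K. scaleC G (of_int (Poly_Mapping.lookup t l)) (f l))"
  unfolding word_sum_def using assms by (intro sum.mono_neutral_left) (auto simp: in_keys_iff)

lemma word_sum_diff: "word_sum G f (s - t) = word_sum G f s - word_sum G f t"
proof -
  let ?K = "Poly_Mapping.keys s \<union> Poly_Mapping.keys t"
  have "Poly_Mapping.keys (s - t) \<subseteq> ?K"
    by (rule keys_diff)
  then show ?thesis
    using word_sum_superset[of ?K "s - t" f] word_sum_superset[of ?K s f]
      word_sum_superset[of ?K t f]
    by (simp add: lookup_minus vs.scale_left_diff_distrib sum_subtractf)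
qed

lemma word_sum_0: "word_sum G f 0 = 0"
  by (simp add: word_sum_def)

lemma word_sum_frag_of: "word_sum G f (frag_of w) = f w"
  by (simp add: word_sum_def)

lemma word_sum_add: "word_sum G f (s + t) = word_sum G f s + word_sum G f t"
  using word_sum_diff[of f "s + t" t] by (simp add: algebra_simps)

lemma word_sum_cong:
  "(\<And>w. w \<in> Poly_Mapping.keys t \<Longrightarrow> f w = g w) \<Longrightarrow> word_sum G f t = word_sum G g t"
  by (simp add: word_sum_def)

lemma word_sum_zero_fun: "word_sum G (\<lambda>w. 0) t = 0"
  by (simp add: word_sum_def)

lemma word_sum_add_fun: "word_sum G (\<lambda>w. f w + g w) t = word_sum G f t + word_sum G g t"
  by (simp add: word_sum_def vs.scale_right_distrib sum.distrib)

lemma word_sum_mult_right: "word_sum G (\<lambda>w. f w * a) t = word_sum G f t * a"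
  by (simp add: word_sum_def sum_distrib_right scaleC_mult_left)

text \<open>Both sides are additive in \<open>t\<close> and agree on single words.\<close>

lemma word_sum_frag_extend:
  "word_sum G f (frag_extend b t) = word_sum G (\<lambda>w. word_sum G f (b w)) t"
proof (rule frag_induction[of t UNIV])
qed (auto simp: word_sum_0 word_sum_frag_of word_sum_diff frag_extend_diff)

lemma word_sum_closed:
  assumes "\<And>w. w \<in> Poly_Mapping.keys t \<Longrightarrow> f w \<in> Form G n"
  shows "word_sum G f t \<in> Form G n"
  unfolding word_sum_def using assms
  by (intro vs.subspace_sum vs.subspace_scale Form_subspace)

section \<open>Spaces of forms and the wedge product on formal sums\<close>

lemma Form_closed:
  shows Form_add: "\<lbrakk>x \<in> Form G n; y \<in> Form G n\<rbrakk> \<Longrightarrow> x + y \<in> Form G n"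
    and Form_diff: "\<lbrakk>x \<in> Form G n; y \<in> Form G n\<rbrakk> \<Longrightarrow> x - y \<in> Form G n"
    and Form_scale: "x \<in> Form G n \<Longrightarrow> scaleC G c x \<in> Form G n"
    and Form_0: "0 \<in> Form G n"
  using Form_subspace by (auto intro: vs.subspace_add vs.subspace_diff vs.subspace_scale vs.subspace_0)

lemma Form_mult_left: "\<lbrakk>a \<in> Form G 0; x \<in> Form G n\<rbrakk> \<Longrightarrow> a * x \<in> Form G n"
  using Form_mult[of a 0 x n] by simp

lemma Form_mult_right: "\<lbrakk>x \<in> Form G n; a \<in> Form G 0\<rbrakk> \<Longrightarrow> x * a \<in> Form G n"
  using Form_mult[of x n a 0] by simp

text \<open>Scalars act as right multiplication by elements of the coordinate algebra. Hence right
  linearity of vector fields and of \<open>J\<close> contains complex linearity.\<close>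

lemma scaleC_eq_mult: "scaleC G c x = x * scaleC G c 1"
  using scaleC_mult_right[of c x 1] by simp

lemma tensor_module_Form: "tensor_module (Form G n) (Form G 0) (*) (*)"
  by unfold_locales (auto intro: Form_add Form_mult_left Form_mult_right)

text \<open>Distributivity and associativity of the product send every relation to 0. The module
  \<open>N\<close> is left open because both all one-forms and the (1,0)-forms are needed.\<close>

lemma wedge_class:
  assumes "tensor_module N (Form G 0) (*) (*)"
  shows "wedge G (tensor_class N (Form G 0) (*) (*) n t) = word_sum G prod_list t"
proof -
  interpret tensor_module N "Form G 0" "(*)" "(*)" by fact
  have null: "word_sum G prod_list s \<in> {0}" if "s \<in> tensor_null N (Form G 0) (*) (*) n" for s
  proof (rule tensor_null_image[OF that])
    fix r assume "r \<in> tensor_rels N (Form G 0) (*) (*) n"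
    then show "word_sum G prod_list r \<in> {0}"
      by (cases rule: tensor_rels_cases)
         (simp_all add: word_sum_diff word_sum_frag_of distrib_left distrib_right mult.assoc)
  qed (simp_all add: word_sum_diff)
  have "word_sum G prod_list s = word_sum G prod_list t"
    if "s \<in> tensor_class N (Form G 0) (*) (*) n t" for s
    using null[of "s - t"] that by (simp add: mem_tensor_class word_sum_diff)
  then show ?thesis
    unfolding wedge_def by (simp add: image_tensor_class)
qed

text \<open>Two-forms are complex combinations of products of two one-forms, whereas formal sums
  have integer coefficients; each complex scalar is absorbed into the first factor of its
  word.\<close>

lemma wedge_surj:
  assumes "\<omega> \<in> Form G 2"
  shows "\<exists>t. Poly_Mapping.keys t \<subseteq> words (Form G 1) 2 \<and> word_sum G prod_list t = \<omega>"
proof -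
  have "\<omega> \<in> vs.span (prod_list ` words (Form G 1) 2)"
    using assms Form_generated[of 2] by simp
  then show ?thesis
  proof (induction rule: vs.span_induct_alt)
    case base
    show ?case by (intro exI[of _ 0]) (simp add: word_sum_0)
  next
    case (step c v \<omega>)
    then obtain x y t where *: "x \<in> Form G 1" "y \<in> Form G 1" "v = x * y"
      "Poly_Mapping.keys t \<subseteq> words (Form G 1) 2" "word_sum G prod_list t = \<omega>"
      by (auto simp: words_2)
    have "Poly_Mapping.keys (frag_of [scaleC G c x, y] + t) \<subseteq> words (Form G 1) 2"
      using * Poly_Mapping.keys_add[of "frag_of [scaleC G c x, y]" t]
        Form_scale[OF *(1), of c] words_2[of "[scaleC G c x, y]" "Form G 1"] by auto
    moreover have "word_sum G prod_list (frag_of [scaleC G c x, y] + t) = scaleC G c v + \<omega>"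
      using * by (simp add: word_sum_add word_sum_frag_of scaleC_mult_left)
    ultimately show ?case by blast
  qed
qed

section \<open>Vector fields as complex linear maps\<close>

lemma VecD:
  assumes "v \<in> Vec G"
  shows Vec_Form: "\<xi> \<in> Form G 1 \<Longrightarrow> v \<xi> \<in> Form G 0"
    and Vec_add: "\<lbrakk>\<xi> \<in> Form G 1; \<eta> \<in> Form G 1\<rbrakk> \<Longrightarrow> v (\<xi> + \<eta>) = v \<xi> + v \<eta>"
    and Vec_mult: "\<lbrakk>\<xi> \<in> Form G 1; a \<in> Form G 0\<rbrakk> \<Longrightarrow> v (\<xi> * a) = v \<xi> * a"
    and Vec_outside: "\<xi> \<notin> Form G 1 \<Longrightarrow> v \<xi> = 0"
  using assms by (auto simp: Vec_def right_module_hom_def)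

lemma Vec_0: "v \<in> Vec G \<Longrightarrow> v 0 = 0"
  using Vec_add[of v 0 0] Form_0 by simp

lemma Vec_scale:
  assumes "v \<in> Vec G" "\<xi> \<in> Form G 1"
  shows "v (scaleC G c \<xi>) = scaleC G c (v \<xi>)"
  using Vec_mult[OF assms, of "scaleC G c 1"] Form_scale Form_one
  by (metis scaleC_eq_mult)

lemma Vec_plus: "\<lbrakk>u \<in> Vec G; v \<in> Vec G\<rbrakk> \<Longrightarrow> u + v \<in> Vec G"
  unfolding Vec_def right_module_hom_def
  by (auto simp: algebra_simps intro!: Form_add)

lemma Vec_scale_Vec: "v \<in> Vec G \<Longrightarrow> scale_Vec G c v \<in> Vec G"
  unfolding Vec_def right_module_hom_def scale_Vec_def
  by (auto simp: vs.scale_right_distrib scaleC_mult_left intro!: Form_scale)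

lemma tensor_module_Vec: "tensor_module (Vec G) UNIV (\<lambda>v c. scale_Vec G c v) (scale_Vec G)"
  by unfold_locales (auto intro: Vec_plus Vec_scale_Vec)

section \<open>The evaluation pairing on representatives\<close>

definition pairing :: "(('w \<Rightarrow> 'w) list \<Rightarrow>\<^sub>0 int) \<Rightarrow> ('w list \<Rightarrow>\<^sub>0 int) \<Rightarrow> 'w" where
  "pairing s t = word_sum G (\<lambda>us. word_sum G (\<lambda>\<xi>s. (us ! 0) ((us ! 1) (\<xi>s ! 0) * \<xi>s ! 1)) t) s"

lemma pairing_diff_left: "pairing (r - s) t = pairing r t - pairing s t"
  by (simp add: pairing_def word_sum_diff)

lemma pairing_diff_right: "pairing s (t - r) = pairing s t - pairing s r"
  using word_sum_add_fun[of _ _ s]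
  by (simp add: pairing_def word_sum_diff algebra_simps flip: word_sum_add_fun)

lemma pairing_add_right: "pairing s (t + r) = pairing s t + pairing s r"
  using pairing_diff_right[of s "t + r" r] by (simp add: algebra_simps)

text \<open>Reduces a comparison of two formal sums of one-forms to a single pair of vector
  fields.\<close>

lemma pairing_cong:
  assumes "\<And>u v. \<lbrakk>u \<in> V; v \<in> V\<rbrakk> \<Longrightarrow>
      word_sum G (\<lambda>\<xi>s. u (v (\<xi>s ! 0) * \<xi>s ! 1)) t = word_sum G (\<lambda>\<xi>s. u (v (\<xi>s ! 0) * \<xi>s ! 1)) t'"
    and "Poly_Mapping.keys s \<subseteq> words V 2"
  shows "pairing s t = pairing s t'"
  unfolding pairing_def
proof (rule word_sum_cong)
  fix us assume "us \<in> Poly_Mapping.keys s"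
  then obtain u v where "u \<in> V" "v \<in> V" "us = [u, v]"
    using assms(2) by (rule keys_words_2E)
  then show "word_sum G (\<lambda>\<xi>s. (us ! 0) ((us ! 1) (\<xi>s ! 0) * \<xi>s ! 1)) t =
      word_sum G (\<lambda>\<xi>s. (us ! 0) ((us ! 1) (\<xi>s ! 0) * \<xi>s ! 1)) t'"
    using assms(1)[of u v] by simp
qed

text \<open>For fixed \<open>u\<close> and \<open>v\<close>, the term u(v(\<xi>) \<eta>) is additive
  in both forms, and it is balanced because v(\<xi> a) \<eta> = v(\<xi>) a \<eta> by right linearity
  of \<open>v\<close>.\<close>

lemma pairing_null_right:
  assumes s: "Poly_Mapping.keys s \<subseteq> words (Vec G) 2"
    and t: "t \<in> tensor_null (Form G 1) (Form G 0) (*) (*) 2"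
  shows "pairing s t = 0"
proof -
  interpret tensor_module "Form G 1" "Form G 0" "(*)" "(*)"
    by (rule tensor_module_Form)
  have "word_sum G (\<lambda>\<xi>s. u (v (\<xi>s ! 0) * \<xi>s ! 1)) t \<in> {0}" if uv: "u \<in> Vec G" "v \<in> Vec G" for u v
  proof (rule tensor_null_image[OF t])
    fix r assume "r \<in> tensor_rels (Form G 1) (Form G 0) (*) (*) 2"
    then show "word_sum G (\<lambda>\<xi>s. u (v (\<xi>s ! 0) * \<xi>s ! 1)) r \<in> {0}"
    proof (cases rule: tensor_rels_2_cases)
      case (left x y z)
      then show ?thesis
        using uv by (simp add: word_sum_diff word_sum_frag_of Vec_add Vec_Form Form_mult_left distrib_right)
    next
      case (right x y z)
      then show ?thesis
        using uv by (simp add: word_sum_diff word_sum_frag_of Vec_add Vec_Form Form_mult_left distrib_left)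
    next
      case (balance x y a)
      then show ?thesis
        using uv by (simp add: word_sum_diff word_sum_frag_of Vec_mult mult.assoc)
    qed
  qed (auto simp: word_sum_diff)
  then have "pairing s t = pairing s 0"
    by (intro pairing_cong[OF _ s]) (simp add: word_sum_0)
  then show ?thesis
    using pairing_diff_right[of s 0 0] by simp
qed

text \<open>For fixed \<open>t\<close>, the pairing is additive in both vector fields. It is
  balanced over the complex numbers because \<open>u\<close> is complex linear, so a scalar on
  v(\<xi>) can be pulled out of \<open>u\<close>.\<close>

lemma pairing_null_left:
  assumes t: "Poly_Mapping.keys t \<subseteq> words (Form G 1) 2"
    and s: "s \<in> tensor_null (Vec G) UNIV (\<lambda>v c. scale_Vec G c v) (scale_Vec G) 2"
  shows "pairing s t = 0"
proof -
  interpret tensor_module "Vec G" UNIV "\<lambda>v c. scale_Vec G c v" "scale_Vec G"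
    by (rule tensor_module_Vec)
  define f where "f u v = word_sum G (\<lambda>\<xi>s. u (v (\<xi>s ! 0) * \<xi>s ! 1)) t" for u v
  have p: "pairing (frag_of [u, v]) t = f u v" for u v
    by (simp add: pairing_def word_sum_frag_of f_def)
  have left: "f (u + v) w = f u w + f v w" for u v w
    unfolding f_def by (simp only: plus_fun_apply word_sum_add_fun)
  have right: "f w (u + v) = f w u + f w v" if "u \<in> Vec G" "v \<in> Vec G" "w \<in> Vec G" for u v w
    unfolding f_def word_sum_add_fun[symmetric]
  proof (rule word_sum_cong)
    fix \<xi>s assume "\<xi>s \<in> Poly_Mapping.keys t"
    then obtain \<xi> \<eta> where "\<xi> \<in> Form G 1" "\<eta> \<in> Form G 1" "\<xi>s = [\<xi>, \<eta>]"
      using t by (rule keys_words_2E)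
    then show "w ((u + v) (\<xi>s ! 0) * \<xi>s ! 1) = w (u (\<xi>s ! 0) * \<xi>s ! 1) + w (v (\<xi>s ! 0) * \<xi>s ! 1)"
      using that by (simp add: distrib_right Vec_add Vec_Form Form_mult_left)
  qed
  have bal: "f (scale_Vec G c u) v = f u (scale_Vec G c v)" if "u \<in> Vec G" "v \<in> Vec G" for u v c
    unfolding f_def
  proof (rule word_sum_cong)
    fix \<xi>s assume "\<xi>s \<in> Poly_Mapping.keys t"
    then obtain \<xi> \<eta> where *: "\<xi> \<in> Form G 1" "\<eta> \<in> Form G 1" "\<xi>s = [\<xi>, \<eta>]"
      using t by (rule keys_words_2E)
    then have "scaleC G c (u (v \<xi> * \<eta>)) = u (scaleC G c (v \<xi> * \<eta>))"
      using that by (simp only: Vec_scale Vec_Form Form_mult_left)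
    then show "scale_Vec G c u (v (\<xi>s ! 0) * \<xi>s ! 1) = u (scale_Vec G c v (\<xi>s ! 0) * \<xi>s ! 1)"
      using * by (simp add: scale_Vec_def scaleC_mult_left)
  qed
  have "pairing s t \<in> {0}"
  proof (rule tensor_null_image[OF s])
    fix r assume "r \<in> tensor_rels (Vec G) UNIV (\<lambda>v c. scale_Vec G c v) (scale_Vec G) 2"
    then show "pairing r t \<in> {0}"
      by (cases rule: tensor_rels_2_cases) (simp_all add: pairing_diff_left p left right bal)
  qed (simp_all add: pairing_diff_left)
  then show ?thesis by simp
qed

lemma ev2_class:
  assumes s: "Poly_Mapping.keys s \<subseteq> words (Vec G) 2"
    and t: "Poly_Mapping.keys t \<subseteq> words (Form G 1) 2"
  shows "ev2 G (tensor_class (Vec G) UNIV (\<lambda>v c. scale_Vec G c v) (scale_Vec G) 2 s)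
      (tensor_class (Form G 1) (Form G 0) (*) (*) 2 t) = pairing s t"
    (is "ev2 G ?S ?T = _")
proof -
  interpret V: tensor_module "Vec G" UNIV "\<lambda>v c. scale_Vec G c v" "scale_Vec G"
    by (rule tensor_module_Vec)
  interpret F: tensor_module "Form G 1" "Form G 0" "(*)" "(*)"
    by (rule tensor_module_Form)
  \<comment> \<open>First \<open>s'\<close> is replaced by \<open>s\<close> against
    \<open>t'\<close>, then \<open>t'\<close> by \<open>t\<close> against \<open>s\<close>; the
    first move needs the words of \<open>t'\<close> to consist of one-forms.\<close>
  have const: "pairing s' t' = pairing s t" if "s' \<in> ?S" "t' \<in> ?T" for s' t'
    using that pairing_null_left[OF F.tensor_class_keys[OF t that(2)], of "s' - s"]
      pairing_null_right[OF s, of "t' - t"]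
    by (simp add: mem_tensor_class pairing_diff_left pairing_diff_right)
  have "(\<lambda>(s, t). pairing s t) ` (?S \<times> ?T) = (\<lambda>_. pairing s t) ` (?S \<times> ?T)"
    by (rule image_cong) (auto simp: const)
  also have "\<dots> = {pairing s t}"
    by (rule image_constant[of "(s, t)"]) (simp add: V.tensor_class_refl F.tensor_class_refl)
  finally show ?thesis
    unfolding ev2_def pairing_def[symmetric] by simp
qed

section \<open>The map \<open>phi\<close> on representatives\<close>

definition der_term :: "(('w \<Rightarrow> 'w) list \<Rightarrow>\<^sub>0 int) \<Rightarrow> 'w \<Rightarrow> 'w" where
  "der_term s \<xi> = word_sum G (\<lambda>us. (us ! 0) (der G ((us ! 1) \<xi>))) s"

lemma der_add: "der G (x + y) = der G x + der G y"
  and der_scale: "der G (scaleC G c x) = scaleC G c (der G x)"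
  using Vector_Spaces.linear.axioms(3)[OF der_linear]
  by (simp_all add: module_hom_def module_hom_axioms_def)

lemma der_0: "der G 0 = 0"
  using der_add[of 0 0] by simp

lemma der_Form_1: "x \<in> Form G 0 \<Longrightarrow> der G x \<in> Form G 1"
  using der_Form[of x 0] by (simp add: One_nat_def)

text \<open>Balancedness here uses that both d and \<open>u\<close> commute with complex scalars.
  Since d need not be linear over the algebra, the tensor product of vector fields has to be taken
  over the complex numbers.\<close>

lemma der_term_class:
  assumes \<xi>: "\<xi> \<in> Form G 1"
  shows "the_elem (word_sum G (\<lambda>us. (us ! 0) (der G ((us ! 1) \<xi>))) `
      tensor_class (Vec G) UNIV (\<lambda>v c. scale_Vec G c v) (scale_Vec G) 2 s) = der_term s \<xi>"
    (is "the_elem (?f ` ?S) = _")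
proof -
  interpret V: tensor_module "Vec G" UNIV "\<lambda>v c. scale_Vec G c v" "scale_Vec G"
    by (rule tensor_module_Vec)
  have null: "?f t \<in> {0}"
    if "t \<in> tensor_null (Vec G) UNIV (\<lambda>v c. scale_Vec G c v) (scale_Vec G) 2" for t
  proof (rule V.tensor_null_image[OF that])
    fix r assume "r \<in> tensor_rels (Vec G) UNIV (\<lambda>v c. scale_Vec G c v) (scale_Vec G) 2"
    then show "?f r \<in> {0}"
      by (cases rule: tensor_rels_2_cases)
         (auto simp: word_sum_diff word_sum_frag_of der_add Vec_add Vec_Form der_Form_1 \<xi>
            scale_Vec_def der_scale Vec_scale)
  qed (auto simp: word_sum_diff)
  have "?f t = ?f s" if "t \<in> ?S" for t
    using null[of "t - s"] that by (simp add: mem_tensor_class word_sum_diff)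
  then have "?f ` ?S = {?f s}"
    by (rule V.image_tensor_class)
  then show ?thesis
    by (simp add: der_term_def)
qed

definition kills_ker_wedge :: "(('w \<Rightarrow> 'w) list \<Rightarrow>\<^sub>0 int) \<Rightarrow> bool" where
  "kills_ker_wedge s \<longleftrightarrow> (\<forall>t. Poly_Mapping.keys t \<subseteq> words (Form G 1) 2 \<longrightarrow>
     word_sum G prod_list t = 0 \<longrightarrow> pairing s t = 0)"

lemma class_in_AntiVec2:
  assumes s: "Poly_Mapping.keys s \<subseteq> words (Vec G) 2"
    and anti: "kills_ker_wedge s"
  shows "tensor_class (Vec G) UNIV (\<lambda>v c. scale_Vec G c v) (scale_Vec G) 2 s \<in> AntiVec2 G"
  using s anti
  by (auto simp: kills_ker_wedge_def AntiVec2_def vec_tensor_def form_tensor_def carrier_tensor_power_iff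
      wedge_class[OF tensor_module_Form] ev2_class[OF s])

text \<open>Two lifts of d\<xi> differ by an element of the kernel of the wedge map, which
  \<open>s\<close> annihilates. So the set in the definition of \<open>phi\<close> is a singleton
  and any lift \<open>t\<close> may be used.\<close>

lemma phi_class:
  assumes s: "Poly_Mapping.keys s \<subseteq> words (Vec G) 2"
    and anti: "kills_ker_wedge s"
    and \<xi>: "\<xi> \<in> Form G 1"
    and t: "Poly_Mapping.keys t \<subseteq> words (Form G 1) 2" "word_sum G prod_list t = der G \<xi>"
  shows "phi G (tensor_class (Vec G) UNIV (\<lambda>v c. scale_Vec G c v) (scale_Vec G) 2 s) \<xi> =
      der_term s \<xi> + pairing s t" (is "phi G ?S \<xi> = _")
proof -
  let ?T = "tensor_class (Form G 1) (Form G 0) (*) (*) 2"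
  note F = tensor_module_Form[of 1]
  have carrier_iff: "z \<in> carrier (form_tensor G (Form G 1) 2) \<longleftrightarrow>
      (\<exists>r. Poly_Mapping.keys r \<subseteq> words (Form G 1) 2 \<and> z = ?T r)" for z
    by (simp add: form_tensor_def carrier_tensor_power_iff)
  have indep: "pairing s r = pairing s t"
    if "Poly_Mapping.keys r \<subseteq> words (Form G 1) 2" "word_sum G prod_list r = der G \<xi>" for r
  proof -
    have "Poly_Mapping.keys (r - t) \<subseteq> words (Form G 1) 2"
      using that t keys_diff[of r t] by blast
    moreover have "word_sum G prod_list (r - t) = 0"
      using that t by (simp add: word_sum_diff)
    ultimately have "pairing s (r - t) = 0"
      using anti by (simp add: kills_ker_wedge_def)
    then show ?thesis
      by (simp add: pairing_diff_right)
  qed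
  have "{der_term s \<xi> + ev2 G ?S z | z.
      z \<in> carrier (form_tensor G (Form G 1) 2) \<and> wedge G z = der G \<xi>} = {der_term s \<xi> + pairing s t}"
    (is "?L = ?R")
  proof
    show "?L \<subseteq> ?R"
      by (auto simp: carrier_iff wedge_class[OF F] ev2_class[OF s] indep)
    have "?T t \<in> carrier (form_tensor G (Form G 1) 2) \<and> wedge G (?T t) = der G \<xi>"
      using t carrier_iff wedge_class[OF F] by auto
    then have "der_term s \<xi> + ev2 G ?S (?T t) \<in> ?L"
      by blast
    then show "?R \<subseteq> ?L"
      by (simp add: ev2_class[OF s t(1)])
  qed
  then show ?thesis
    using \<xi> class_in_AntiVec2[OF s anti] by (simp add: phi_def der_term_class[OF \<xi>])
qed

lemma pairing_frag_of: "pairing s (frag_of [\<xi>, \<eta>]) = word_sum G (\<lambda>us. (us ! 0) ((us ! 1) \<xi> * \<eta>)) s"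
  by (simp add: pairing_def word_sum_frag_of)

lemma keys_frag_extend_words:
  assumes "Poly_Mapping.keys t \<subseteq> words M 2"
    and "\<And>x y. \<lbrakk>x \<in> M; y \<in> M\<rbrakk> \<Longrightarrow> Poly_Mapping.keys (b [x, y]) \<subseteq> words N 2"
  shows "Poly_Mapping.keys (frag_extend b t) \<subseteq> words N 2"
proof -
  have "Poly_Mapping.keys (b w) \<subseteq> words N 2" if "w \<in> Poly_Mapping.keys t" for w
    using that assms(1) by (rule keys_words_2E) (simp add: assms(2))
  then show ?thesis
    using keys_frag_extend[of b t] by blast
qed

text \<open>Lifts of d\<xi> exist by \<open>wedge_surj\<close>, and additivity follows by adding
  lifts. For right linearity, the term v(\<xi>) da from the Leibniz rule on functions cancels
  against the term \<xi> da from the Leibniz rule on one-forms.\<close>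

lemma phi_class_Vec:
  assumes s: "Poly_Mapping.keys s \<subseteq> words (Vec G) 2"
    and anti: "kills_ker_wedge s"
  shows "phi G (tensor_class (Vec G) UNIV (\<lambda>v c. scale_Vec G c v) (scale_Vec G) 2 s) \<in> Vec G"
    (is "?\<phi> \<in> _")
proof -
  have lift: "\<exists>t. Poly_Mapping.keys t \<subseteq> words (Form G 1) 2 \<and> word_sum G prod_list t = der G \<xi>"
    if "\<xi> \<in> Form G 1" for \<xi>
    using der_Form[OF that] by (intro wedge_surj) (simp add: numeral_2_eq_2 One_nat_def)
  note phi = phi_class[OF s anti]
  have "?\<phi> \<xi> \<in> Form G 0" if \<xi>: "\<xi> \<in> Form G 1" for \<xi>
  proof -
    obtain t where t: "Poly_Mapping.keys t \<subseteq> words (Form G 1) 2" "word_sum G prod_list t = der G \<xi>"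
      using lift[OF \<xi>] by blast
    have "(us ! 0) (der G ((us ! 1) \<xi>)) \<in> Form G 0" if "us \<in> Poly_Mapping.keys s" for us
      using that s by (rule keys_words_2E) (simp add: Vec_Form der_Form_1 \<xi>)
    moreover have "word_sum G (\<lambda>\<xi>s. (us ! 0) ((us ! 1) (\<xi>s ! 0) * \<xi>s ! 1)) t \<in> Form G 0"
      if us: "us \<in> Poly_Mapping.keys s" for us
    proof (rule word_sum_closed)
      fix \<xi>s assume \<xi>s: "\<xi>s \<in> Poly_Mapping.keys t"
      show "(us ! 0) ((us ! 1) (\<xi>s ! 0) * \<xi>s ! 1) \<in> Form G 0"
        by (rule keys_words_2E[OF us s], rule keys_words_2E[OF \<xi>s t(1)])
          (simp add: Vec_Form Form_mult_left)
    qed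
    ultimately show ?thesis
      unfolding phi[OF \<xi> t] der_term_def pairing_def by (intro Form_add word_sum_closed[where t = s])
  qed
  moreover have "?\<phi> (\<xi> + \<eta>) = ?\<phi> \<xi> + ?\<phi> \<eta>" if \<xi>: "\<xi> \<in> Form G 1" and \<eta>: "\<eta> \<in> Form G 1" for \<xi> \<eta>
  proof -
    obtain t where t: "Poly_Mapping.keys t \<subseteq> words (Form G 1) 2" "word_sum G prod_list t = der G \<xi>"
      using lift[OF \<xi>] by blast
    obtain r where r: "Poly_Mapping.keys r \<subseteq> words (Form G 1) 2" "word_sum G prod_list r = der G \<eta>"
      using lift[OF \<eta>] by blast
    have "Poly_Mapping.keys (t + r) \<subseteq> words (Form G 1) 2"
      using t(1) r(1) Poly_Mapping.keys_add[of t r] by blast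
    moreover have "word_sum G prod_list (t + r) = der G (\<xi> + \<eta>)"
      by (simp add: word_sum_add t r der_add)
    moreover have "der_term s (\<xi> + \<eta>) = der_term s \<xi> + der_term s \<eta>"
      unfolding der_term_def word_sum_add_fun[symmetric]
    proof (rule word_sum_cong)
      fix us assume "us \<in> Poly_Mapping.keys s"
      then show "(us ! 0) (der G ((us ! 1) (\<xi> + \<eta>))) =
          (us ! 0) (der G ((us ! 1) \<xi>)) + (us ! 0) (der G ((us ! 1) \<eta>))"
        using s by (rule keys_words_2E) (simp add: Vec_add der_add Vec_Form der_Form_1 \<xi> \<eta>)
    qed
    ultimately show ?thesis
      using \<xi> \<eta> by (simp add: phi[OF \<xi> t] phi[OF \<eta> r] phi[of _ "t + r"] Form_add pairing_add_right)
  qed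
  moreover have "?\<phi> (\<xi> * a) = ?\<phi> \<xi> * a" if \<xi>: "\<xi> \<in> Form G 1" and a: "a \<in> Form G 0" for \<xi> a
  proof -
    obtain t where t: "Poly_Mapping.keys t \<subseteq> words (Form G 1) 2" "word_sum G prod_list t = der G \<xi>"
      using lift[OF \<xi>] by blast
    \<comment> \<open>The right multiple of \<open>t\<close> by \<open>a\<close>, formed in the last
      slot; it lifts the product of d\<xi> with \<open>a\<close>.\<close>
    define ta where "ta = frag_extend (\<lambda>w. frag_of [w ! 0, w ! 1 * a]) t"
    have keys: "Poly_Mapping.keys ta \<subseteq> words (Form G 1) 2"
      unfolding ta_def using t(1)
      by (rule keys_frag_extend_words) (simp add: words_2 Form_mult_right a)
    have "word_sum G prod_list ta = word_sum G (\<lambda>w. prod_list w * a) t"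
      unfolding ta_def word_sum_frag_extend
    proof (rule word_sum_cong)
      fix w assume "w \<in> Poly_Mapping.keys t"
      then show "word_sum G prod_list (frag_of [w ! 0, w ! 1 * a]) = prod_list w * a"
        using t(1) by (rule keys_words_2E) (simp add: word_sum_frag_of mult.assoc)
    qed
    then have wedge_ta: "word_sum G prod_list ta = der G \<xi> * a"
      by (simp add: word_sum_mult_right t)
    have pairing_ta: "pairing s ta = pairing s t * a"
      unfolding pairing_def word_sum_mult_right[symmetric] ta_def word_sum_frag_extend
    proof (intro word_sum_cong)
      fix us w assume us: "us \<in> Poly_Mapping.keys s" and w: "w \<in> Poly_Mapping.keys t"
      show "word_sum G (\<lambda>\<xi>s. (us ! 0) ((us ! 1) (\<xi>s ! 0) * \<xi>s ! 1)) (frag_of [w ! 0, w ! 1 * a]) =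
          (us ! 0) ((us ! 1) (w ! 0) * w ! 1) * a"
        by (rule keys_words_2E[OF us s], rule keys_words_2E[OF w t(1)])
          (simp add: word_sum_frag_of Vec_Form Form_mult_left a flip: mult.assoc Vec_mult)
    qed
    \<comment> \<open>The extra pairing is the contribution of v(\<xi>) da in d(v(\<xi>) a).\<close>
    have der_term: "der_term s (\<xi> * a) = der_term s \<xi> * a + pairing s (frag_of [\<xi>, der G a])"
      unfolding der_term_def pairing_frag_of word_sum_mult_right[symmetric] word_sum_add_fun[symmetric]
    proof (rule word_sum_cong)
      fix us assume "us \<in> Poly_Mapping.keys s"
      then show "(us ! 0) (der G ((us ! 1) (\<xi> * a))) =
          (us ! 0) (der G ((us ! 1) \<xi>)) * a + (us ! 0) ((us ! 1) \<xi> * der G a)"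
      using s
      proof (rule keys_words_2E)
        fix u v assume uv: "u \<in> Vec G" "v \<in> Vec G" "us = [u, v]"
        have "der G (v (\<xi> * a)) = der G (v \<xi>) * a + v \<xi> * der G a"
          using der_Leibniz[of "v \<xi>" 0 a] uv \<xi> a by (simp add: Vec_mult Vec_Form)
        then show ?thesis
          using uv \<xi> a by (simp add: Vec_add Vec_mult Vec_Form der_Form_1 Form_mult_left Form_mult_right)
      qed
    qed
    \<comment> \<open>This difference lifts d(\<xi> a); the minus sign is that of the Leibniz rule
      in degree one.\<close>
    have "Poly_Mapping.keys (ta - frag_of [\<xi>, der G a]) \<subseteq> words (Form G 1) 2"
      using keys keys_diff[of ta "frag_of [\<xi>, der G a]"] words_2[of "[\<xi>, der G a]" "Form G 1"]
        \<xi> der_Form_1[OF a] by auto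
    moreover have "word_sum G prod_list (ta - frag_of [\<xi>, der G a]) = der G (\<xi> * a)"
      using der_Leibniz[OF \<xi>, of a] by (simp add: word_sum_diff word_sum_frag_of wedge_ta)
    ultimately have "?\<phi> (\<xi> * a) = der_term s (\<xi> * a) + pairing s (ta - frag_of [\<xi>, der G a])"
      using \<xi> a by (intro phi) (simp_all add: Form_mult_right)
    then show ?thesis
      by (simp add: der_term pairing_diff_right pairing_ta phi[OF \<xi> t] distrib_right)
  qed
  moreover have "?\<phi> \<xi> = 0" if "\<xi> \<notin> Form G 1" for \<xi>
    using that class_in_AntiVec2[OF s anti] by (simp add: phi_def)
  ultimately show ?thesis
    by (simp add: Vec_def right_module_hom_def)
qed

end


section \<open>Forms and vector fields of type (1,0)\<close>

context almost_complex
begin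

interpretation vs: vector_space "scaleC G"
  by (rule scaleC)

section \<open>The action of \<open>J\<close> on formal sums\<close>

definition J_words :: "('w list \<Rightarrow>\<^sub>0 int) \<Rightarrow> ('w list \<Rightarrow>\<^sub>0 int)" where
  "J_words = frag_extend (\<lambda>w. \<Sum>i<length w. frag_of (w[i := J (w ! i)]))"

lemma J_words_diff: "J_words (s - t) = J_words s - J_words t"
  by (simp add: J_words_def frag_extend_diff)

lemma J_words_0: "J_words 0 = 0"
  by (simp add: J_words_def)

lemma J_words_1: "J_words (frag_of [x]) = frag_of [J x]"
  by (simp add: J_words_def)

lemma J_words_2: "J_words (frag_of [x, y]) = frag_of [J x, y] + frag_of [x, J y]"
  by (simp add: J_words_def)

lemma keys_J_words:
  assumes "Poly_Mapping.keys t \<subseteq> words (Form G 1) 2"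
  shows "Poly_Mapping.keys (J_words t) \<subseteq> words (Form G 1) 2"
  unfolding J_words_def using assms
proof (rule keys_frag_extend_words)
  fix x y assume xy: "x \<in> Form G 1" "y \<in> Form G 1"
  have "Poly_Mapping.keys (frag_of [J x, y] + frag_of [x, J y]) \<subseteq> words (Form G 1) 2"
    using xy J_Form Poly_Mapping.keys_add[of "frag_of [J x, y]" "frag_of [x, J y]"]
      words_2[of "[J x, y]" "Form G 1"] words_2[of "[x, J y]" "Form G 1"] by auto
  then show "Poly_Mapping.keys (\<Sum>i<length [x, y]. frag_of ([x, y][i := J ([x, y] ! i)]))
      \<subseteq> words (Form G 1) 2"
    by simp
qed

text \<open>Letting \<open>J\<close> act as a derivation turns an additivity relation in length two
  into two such relations, one for each slot. A balancing relation also splits into two, because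
  \<open>J\<close> commutes with both actions of the algebra.\<close>

lemma J_words_null:
  assumes n: "n = 1 \<or> n = 2"
    and t: "t \<in> tensor_null (Form G 1) (Form G 0) (*) (*) n"
  shows "J_words t \<in> tensor_null (Form G 1) (Form G 0) (*) (*) n"
proof -
  interpret F: tensor_module "Form G 1" "Form G 0" "(*)" "(*)"
    by (rule tensor_module_Form)
  show ?thesis
  proof (rule F.tensor_null_image[OF t])
    fix r assume r: "r \<in> tensor_rels (Form G 1) (Form G 0) (*) (*) n"
    show "J_words r \<in> tensor_null (Form G 1) (Form G 0) (*) (*) n"
      using n
    proof
      assume "n = 1"
      then obtain x y where xy: "x \<in> Form G 1" "y \<in> Form G 1"
        "r = frag_of [x + y] - frag_of [x] - frag_of [y]"
        using r by (auto simp: tensor_rels_1)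
      then have "J_words r = frag_of [J x + J y] - frag_of [J x] - frag_of [J y]"
        by (simp add: J_words_diff J_words_1 J_add)
      then have "J_words r \<in> tensor_rels (Form G 1) (Form G 0) (*) (*) n"
        unfolding \<open>n = 1\<close> tensor_rels_1 using xy J_Form by blast
      then show ?thesis
        by (rule F.tensor_null_rel)
    next
      assume [simp]: "n = 2"
      note sum_rels = F.tensor_null_add[OF F.tensor_null_rel F.tensor_null_rel]
      from r have "r \<in> tensor_rels (Form G 1) (Form G 0) (*) (*) 2"
        by simp
      then show ?thesis
      proof (cases rule: tensor_rels_2_cases)
        case (left x y z)
        then have "J_words r = (frag_of [J x + J y, z] - frag_of [J x, z] - frag_of [J y, z]) +
            (frag_of [x + y, J z] - frag_of [x, J z] - frag_of [y, J z])"
          by (simp add: J_words_diff J_words_2 J_add)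
        with left show ?thesis
          by (simp add: J_Form sum_rels tensor_rels_left del: add_diff_eq)
      next
        case (right x y z)
        then have "J_words r = (frag_of [J z, x + y] - frag_of [J z, x] - frag_of [J z, y]) +
            (frag_of [z, J x + J y] - frag_of [z, J x] - frag_of [z, J y])"
          by (simp add: J_words_diff J_words_2 J_add)
        with right show ?thesis
          by (simp add: J_Form sum_rels tensor_rels_right)
      next
        case (balance x y a)
        then have "J_words r = (frag_of [J x * a, y] - frag_of [J x, a * y]) +
            (frag_of [x * a, J y] - frag_of [x, a * J y])"
          by (simp add: J_words_diff J_words_2 J_left J_right)
        with balance show ?thesis
          by (simp add: J_Form sum_rels tensor_rels_balance)
      qed
    qed
  qed (simp_all add: J_words_diff F.tensor_null_0 F.tensor_null_add F.tensor_null_uminus)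
qed

lemma J_tensor_class:
  assumes "n = 1 \<or> n = 2"
  shows "J_tensor G J n (tensor_class (Form G 1) (Form G 0) (*) (*) n t) =
      tensor_class (Form G 1) (Form G 0) (*) (*) n (J_words t)" (is "_ = ?T (J_words t)")
proof -
  interpret F: tensor_module "Form G 1" "Form G 0" "(*)" "(*)"
    by (rule tensor_module_Form)
  have "?T (J_words s) = ?T (J_words t)" if "s \<in> ?T t" for s
    using J_words_null[OF assms, of "s - t"] that
    by (intro F.tensor_class_eqI) (simp add: mem_tensor_class J_words_diff)
  then have "(\<lambda>s. ?T (J_words s)) ` ?T t = {?T (J_words t)}"
    by (rule F.image_tensor_class)
  then show ?thesis
    unfolding J_tensor_def J_words_def[symmetric] tensor_class_def[symmetric] by simp
qed

text \<open>By \<open>J_descends\<close> all lifts of a form give the same result, so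
  \<open>J_form\<close> can be computed on any one of them.\<close>

lemma J_form_word_sum:
  assumes n: "n = 1 \<or> n = 2" and t: "Poly_Mapping.keys t \<subseteq> words (Form G 1) n"
  shows "J_form G J n (word_sum G prod_list t) = word_sum G prod_list (J_words t)"
proof -
  let ?T = "tensor_class (Form G 1) (Form G 0) (*) (*) n"
  note wedge = wedge_class[OF tensor_module_Form[of 1], of n]
  have T: "?T t \<in> carrier (form_tensor G (Form G 1) n)"
    using t by (auto simp: form_tensor_def carrier_tensor_power_iff)
  have wedge_T: "wedge G (?T t) = word_sum G prod_list t"
    by (rule wedge)
  have "wedge G (J_tensor G J n X) = wedge G (J_tensor G J n (?T t))"
    if "X \<in> carrier (form_tensor G (Form G 1) n)" "wedge G X = word_sum G prod_list t" for X
    by (rule J_descends[OF _ that(1) T]) (use n that(2) wedge_T in auto)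
  then have "{wedge G (J_tensor G J n X) | X. X \<in> carrier (form_tensor G (Form G 1) n) \<and>
      wedge G X = word_sum G prod_list t} = {wedge G (J_tensor G J n (?T t))}"
    using T wedge_T by blast
  then show ?thesis
    using n by (auto simp: J_form_def J_tensor_class wedge)
qed

section \<open>Types of one-forms and two-forms\<close>

lemma J_form_1:
  assumes "\<xi> \<in> Form G 1"
  shows "J_form G J 1 \<xi> = J \<xi>"
  using J_form_word_sum[of 1 "frag_of [\<xi>]"] assms
  by (simp add: word_sum_frag_of J_words_1 words_1)

lemma bigraded_1:
  shows bigraded_10: "\<xi> \<in> bigraded G J 1 0 \<longleftrightarrow> \<xi> \<in> Form G 1 \<and> J \<xi> = scaleC G \<i> \<xi>"
    and bigraded_01: "\<xi> \<in> bigraded G J 0 1 \<longleftrightarrow> \<xi> \<in> Form G 1 \<and> J \<xi> = scaleC G (- \<i>) \<xi>"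
  by (auto simp: bigraded_def J_form_1)

lemma bigraded_2:
  shows bigraded_02: "\<omega> \<in> bigraded G J 0 2 \<longleftrightarrow> \<omega> \<in> Form G 2 \<and> J_form G J 2 \<omega> = scaleC G (- 2 * \<i>) \<omega>"
    and bigraded_11: "\<omega> \<in> bigraded G J 1 1 \<longleftrightarrow> \<omega> \<in> Form G 2 \<and> J_form G J 2 \<omega> = 0"
  unfolding bigraded_def add_0 one_add_one by (auto simp: mult.commute)

lemma J_scale: "\<xi> \<in> Form G 1 \<Longrightarrow> J (scaleC G c \<xi>) = scaleC G c (J \<xi>)"
  using J_right[of "scaleC G c 1" \<xi>] Form_scale[OF Form_one, of c]
    scaleC_eq_mult[of c \<xi>] scaleC_eq_mult[of c "J \<xi>"] by simp

lemma J_form_2_add: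
  assumes "\<alpha> \<in> Form G 2" "\<beta> \<in> Form G 2"
  shows "J_form G J 2 (\<alpha> + \<beta>) = J_form G J 2 \<alpha> + J_form G J 2 \<beta>"
proof -
  obtain s t where s: "Poly_Mapping.keys s \<subseteq> words (Form G 1) 2" "word_sum G prod_list s = \<alpha>"
    and t: "Poly_Mapping.keys t \<subseteq> words (Form G 1) 2" "word_sum G prod_list t = \<beta>"
    using assms wedge_surj by meson
  have "Poly_Mapping.keys (s + t) \<subseteq> words (Form G 1) 2"
    using s(1) t(1) Poly_Mapping.keys_add[of s t] by blast
  then show ?thesis
    using J_form_word_sum[of 2 s] J_form_word_sum[of 2 t] J_form_word_sum[of 2 "s + t"] s t
    by (simp add: word_sum_add J_words_def frag_extend_add)
qed

text \<open>A lift of the scaled form carries the scalar in the first slot of each word, and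
  \<open>J\<close> commutes with scalars there.\<close>

lemma J_form_2_scale:
  assumes "\<omega> \<in> Form G 2"
  shows "J_form G J 2 (scaleC G c \<omega>) = scaleC G c (J_form G J 2 \<omega>)"
proof -
  obtain t where t: "Poly_Mapping.keys t \<subseteq> words (Form G 1) 2" "word_sum G prod_list t = \<omega>"
    using assms wedge_surj by blast
  define tc where "tc = frag_extend (\<lambda>w. frag_of [scaleC G c (w ! 0), w ! 1]) t"
  have keys: "Poly_Mapping.keys tc \<subseteq> words (Form G 1) 2"
    unfolding tc_def using t(1)
    by (rule keys_frag_extend_words) (simp add: words_2 Form_scale)
  have "word_sum G prod_list tc = scaleC G c \<omega> \<and>
      word_sum G prod_list (J_words tc) = scaleC G c (word_sum G prod_list (J_words t))"
    unfolding tc_def t(2)[symmetric] using t(1)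
  proof (induction t rule: frag_induction)
    case (one w)
    then obtain x y where "x \<in> Form G 1" "y \<in> Form G 1" "w = [x, y]"
      by (auto simp: words_2)
    then show ?case
      by (simp add: word_sum_frag_of word_sum_add J_words_2 J_scale scaleC_mult_left vs.scale_right_distrib)
  qed (simp_all add: word_sum_0 J_words_0 frag_extend_diff J_words_diff word_sum_diff
      vs.scale_right_diff_distrib)
  then show ?thesis
    using J_form_word_sum[of 2 t] J_form_word_sum[of 2 tc] keys t by simp
qed

section \<open>The projection onto type (1,0)\<close>

definition proj10 :: "'w \<Rightarrow> 'w" where
  "proj10 \<xi> = scaleC G (1 / 2) (\<xi> - scaleC G \<i> (J \<xi>))"

definition proj10_words :: "('w list \<Rightarrow>\<^sub>0 int) \<Rightarrow> ('w list \<Rightarrow>\<^sub>0 int)" where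
  "proj10_words = frag_extend (\<lambda>w. frag_of (map proj10 w))"

text \<open>As \<open>J\<close> squares to -1, applying it to \<xi> - iJ\<xi> gives J\<xi> + i\<xi>
  = i(\<xi> - iJ\<xi>).\<close>

lemma proj10_bigraded:
  assumes "\<xi> \<in> Form G 1"
  shows "proj10 \<xi> \<in> bigraded G J 1 0"
proof -
  have "J (\<xi> - scaleC G \<i> (J \<xi>)) = J \<xi> + scaleC G \<i> \<xi>"
    using J_add[OF assms, OF Form_scale[OF J_Form[OF assms]], of "- \<i>"] assms
    by (simp add: J_scale[OF J_Form] J_J flip: diff_conv_add_uminus)
      (simp add: J_scale[OF J_Form] J_J vs.scale_minus_left[symmetric] del: vs.scale_minus_left)
  also have "\<dots> = scaleC G \<i> (\<xi> - scaleC G \<i> (J \<xi>))"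
    by (simp add: vs.scale_right_diff_distrib)
  finally have "J (proj10 \<xi>) = scaleC G (1 / 2) (scaleC G \<i> (\<xi> - scaleC G \<i> (J \<xi>)))"
    unfolding proj10_def using assms by (subst J_scale) (auto intro: Form_diff Form_scale J_Form)
  then show ?thesis
    unfolding bigraded_10 using assms
    by (auto simp: proj10_def mult.commute intro: Form_diff Form_scale J_Form)
qed

text \<open>On \<open>\<Omega>\<^sup>1 \<otimes> \<Omega>\<^sup>1\<close> let \<open>K = J \<otimes> id + id \<otimes> J\<close>. As \<open>K\<^sup>2 = 2 J \<otimes> J - 2\<close>, the projection
  \<open>(id - iJ) \<otimes> (id - iJ) / 4\<close> equals \<open>- (iK + K\<^sup>2 / 2) / 4\<close>, a polynomial in \<open>K\<close>.\<close>

lemma word_sum_proj10_words: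
  assumes t: "Poly_Mapping.keys t \<subseteq> words (Form G 1) 2" and \<omega>: "word_sum G prod_list t = \<omega>"
  shows "word_sum G prod_list (proj10_words t) =
      scaleC G (- 1 / 4) (scaleC G \<i> (J_form G J 2 \<omega>) + scaleC G (1 / 2) (J_form G J 2 (J_form G J 2 \<omega>)))"
proof -
  have "word_sum G prod_list (proj10_words t) =
      scaleC G (- 1 / 4) (scaleC G \<i> (word_sum G prod_list (J_words t)) +
        scaleC G (1 / 2) (word_sum G prod_list (J_words (J_words t))))"
    using t
  proof (induction t rule: frag_induction)
    case (one w)
    then obtain x y where xy: "x \<in> Form G 1" "y \<in> Form G 1" "w = [x, y]"
      by (auto simp: words_2)
    \<comment> \<open>Both sides expand in these four products: the projection gives (p - iq - ir -
      m)/4, while K gives q + r and its square gives 2(m - p).\<close>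
    define p q r m where "p = x * y" and "q = x * J y" and "r = J x * y" and "m = J x * J y"
    have "word_sum G prod_list (proj10_words (frag_of w)) =
        scaleC G (1 / 4) (p - scaleC G \<i> q - scaleC G \<i> r - m)"
      using xy unfolding p_def q_def r_def m_def
      by (simp add: proj10_words_def word_sum_frag_of proj10_def vs.scale_right_diff_distrib
          left_diff_distrib right_diff_distrib flip: scaleC_mult_left scaleC_mult_right)
    moreover have "word_sum G prod_list (J_words (frag_of w)) = r + q"
      using xy by (simp add: J_words_2 word_sum_add word_sum_frag_of q_def r_def)
    moreover have "word_sum G prod_list (J_words (J_words (frag_of w))) = m + m - p - p"
    proof -
      have "J_words (J_words (frag_of w)) = J_words (frag_of [J x, y]) + J_words (frag_of [x, J y])"
        using xy by (simp add: J_words_2) (simp add: J_words_def frag_extend_add)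
      then show ?thesis
        using xy by (simp add: J_words_2 word_sum_add word_sum_frag_of J_J m_def p_def)
    qed
    moreover have "scaleC G (1 / 2) (m + m - p - p) = m - p"
      using vs.scale_left_distrib[of "1 / 2" "1 / 2" "m - p"]
      by (simp add: algebra_simps)
    ultimately show ?case
      by (simp add: vs.scale_right_distrib vs.scale_right_diff_distrib)
  qed (simp_all add: proj10_words_def word_sum_0 J_words_0 frag_extend_diff J_words_diff word_sum_diff
      vs.scale_right_diff_distrib vs.scale_right_distrib)
  \<comment> \<open>Rewriting through \<open>J_form\<close> makes the right-hand side depend on
    \<omega> only, no longer on the lift \<open>t\<close>.\<close>
  then show ?thesis
    using J_form_word_sum[of 2 t] J_form_word_sum[of 2 "J_words t"] t keys_J_words[OF t] \<omega> by simp
qed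

section \<open>Vector fields of type (1,0)\<close>

lemma Vec10_iff:
  "v \<in> Vec10 G J \<longleftrightarrow> v \<in> Vec G \<and> (\<forall>\<xi>\<in>Form G 1. v (J \<xi>) = scaleC G \<i> (v \<xi>))"
  by (auto simp: Vec10_def J_Vec_def scale_Vec_def fun_eq_iff Vec_outside)

lemma tensor_module_Vec10: "tensor_module (Vec10 G J) UNIV (\<lambda>v c. scale_Vec G c v) (scale_Vec G)"
  by unfold_locales
    (auto simp: Vec10_iff Vec_plus Vec_scale_Vec vs.scale_right_distrib scale_Vec_def[THEN fun_cong]
      mult.commute)

text \<open>Since v(J\<xi>) = i v(\<xi>), the value of \<open>v\<close> at \<xi> - iJ\<xi> is
  2v(\<xi>).\<close>

lemma Vec10_proj10:
  assumes "v \<in> Vec10 G J" "\<xi> \<in> Form G 1"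
  shows "v (proj10 \<xi>) = v \<xi>"
proof -
  have v: "v \<in> Vec G" "v (J \<xi>) = scaleC G \<i> (v \<xi>)"
    using assms by (auto simp: Vec10_iff)
  have "v (\<xi> - scaleC G \<i> (J \<xi>)) = v \<xi> + v \<xi>"
    using Vec_add[OF v(1), of \<xi> "scaleC G (- \<i>) (J \<xi>)"] assms(2)
    by (simp add: Form_scale J_Form Vec_scale v del: vs.scale_minus_left) simp
  then show ?thesis
    using assms(2) vs.scale_left_distrib[of "1 / 2" "1 / 2" "v \<xi>"]
    by (simp add: proj10_def Vec_scale[OF v(1)] Form_diff Form_scale J_Form vs.scale_right_distrib)
qed

lemma proj10_mult_left:
  assumes "a \<in> Form G 0" "\<xi> \<in> Form G 1"
  shows "proj10 (a * \<xi>) = a * proj10 \<xi>"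
  using assms
  by (simp add: proj10_def J_left right_diff_distrib flip: scaleC_mult_right)

text \<open>In the first slot \<open>v\<close> absorbs the projection. In the second, left linearity
  moves the coefficient v(\<xi>) inside the projection, which \<open>u\<close> then absorbs.\<close>

lemma pairing_proj10_words:
  assumes s: "Poly_Mapping.keys s \<subseteq> words (Vec10 G J) 2"
    and t: "Poly_Mapping.keys t \<subseteq> words (Form G 1) 2"
  shows "pairing s (proj10_words t) = pairing s t"
proof (rule pairing_cong[OF _ s])
  fix u v assume uv: "u \<in> Vec10 G J" "v \<in> Vec10 G J"
  show "word_sum G (\<lambda>\<xi>s. u (v (\<xi>s ! 0) * \<xi>s ! 1)) (proj10_words t) =
      word_sum G (\<lambda>\<xi>s. u (v (\<xi>s ! 0) * \<xi>s ! 1)) t"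
    unfolding proj10_words_def word_sum_frag_extend
  proof (rule word_sum_cong)
    fix w assume "w \<in> Poly_Mapping.keys t"
    then obtain \<xi> \<eta> where "\<xi> \<in> Form G 1" "\<eta> \<in> Form G 1" "w = [\<xi>, \<eta>]"
      using t by (rule keys_words_2E)
    moreover from this uv have "v \<xi> \<in> Form G 0"
      by (simp add: Vec10_iff Vec_Form)
    ultimately show "word_sum G (\<lambda>\<xi>s. u (v (\<xi>s ! 0) * \<xi>s ! 1)) (frag_of (map proj10 w)) =
        u (v (w ! 0) * w ! 1)"
      using uv Vec10_proj10[OF uv(1)]
      by (simp add: word_sum_frag_of Vec10_proj10 Form_mult_left flip: proj10_mult_left)
  qed
qed

text \<open>The projection kills forms of type (0,1), so \<open>v\<close> vanishes on them before d
  is applied.\<close>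

lemma der_term_01:
  assumes s: "Poly_Mapping.keys s \<subseteq> words (Vec10 G J) 2" and \<xi>: "\<xi> \<in> bigraded G J 0 1"
  shows "der_term s \<xi> = 0"
proof -
  have "word_sum G (\<lambda>us. (us ! 0) (der G ((us ! 1) \<xi>))) s = word_sum G (\<lambda>us. 0) s"
  proof (rule word_sum_cong)
    fix us assume "us \<in> Poly_Mapping.keys s"
    then obtain u v where uv: "u \<in> Vec10 G J" "v \<in> Vec10 G J" "us = [u, v]"
      using s by (rule keys_words_2E)
    have "proj10 \<xi> = 0"
      using \<xi> by (simp add: bigraded_01 proj10_def)
    then have "v \<xi> = 0"
      using Vec10_proj10[OF uv(2), of \<xi>] \<xi> uv(2) by (simp add: bigraded_01 Vec10_iff Vec_0)
    then show "(us ! 0) (der G ((us ! 1) \<xi>)) = 0"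
      using uv by (simp add: der_0 Vec10_iff Vec_0)
  qed
  then show ?thesis
    by (simp add: der_term_def word_sum_zero_fun)
qed

end

section \<open>Integrability and the type of \<open>phi\<close>\<close>

theorem proposition10p2:
  fixes G :: "'w::{ring, monoid_mult} form_data" and J :: "'w \<Rightarrow> 'w"
  assumes "almost_complex G J"
    and "fin_gen_projective_right (Form G 0) (Form G 1)"
    and "integrable_structure G J"
    and "x \<in> carrier (vec_tensor G (Vec10 G J))"
    and "\<And>k. \<lbrakk>k \<in> carrier (form_tensor G (bigraded G J 1 0) 2); wedge G k = 0\<rbrakk>
           \<Longrightarrow> ev2 G (vec_tensor_incl G x) (form_tensor_incl G 2 k) = 0"
  shows "phi G (vec_tensor_incl G x) \<in> Vec10 G J"
proof -
  interpret almost_complex G J by fact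
  interpret vs: vector_space "scaleC G" by (rule scaleC)
  let ?S = "tensor_class (Vec G) UNIV (\<lambda>v c. scale_Vec G c v) (scale_Vec G) 2"
  let ?T = "tensor_class (Form G 1) (Form G 0) (*) (*) 2"
  let ?N = "tensor_class (bigraded G J 1 0) (Form G 0) (*) (*) 2"
  obtain s where s10: "Poly_Mapping.keys s \<subseteq> words (Vec10 G J) 2"
    and x: "x = tensor_class (Vec10 G J) UNIV (\<lambda>v c. scale_Vec G c v) (scale_Vec G) 2 s"
    using assms(4) by (auto simp: vec_tensor_def carrier_tensor_power_iff)
  have "words (Vec10 G J) 2 \<subseteq> words (Vec G) 2"
    by (auto simp: words_def Vec10_def)
  then have s: "Poly_Mapping.keys s \<subseteq> words (Vec G) 2"
    using s10 by blast
  have incl_x: "vec_tensor_incl G x = ?S s"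
    unfolding vec_tensor_incl_def x
    by (rule tensor_module.tensor_incl_class[OF tensor_module_Vec tensor_module_Vec10])
       (auto simp: Vec10_def)
  have N: "tensor_module (bigraded G J 1 0) (Form G 0) (*) (*)"
    by unfold_locales
       (auto simp: bigraded_10 Form_add Form_mult_left Form_mult_right J_add J_left J_right
         vs.scale_right_distrib simp flip: scaleC_mult_left scaleC_mult_right)
  \<comment> \<open>The projected sum represents a tensor of (1,0)-forms in the kernel of the wedge
    map, so the hypothesis on \<open>x\<close> applies to it; \<open>s\<close> has the same pairing
    with \<open>t\<close> as with the projection.\<close>
  have key: "pairing s t = 0"
    if t: "Poly_Mapping.keys t \<subseteq> words (Form G 1) 2"
      and 0: "word_sum G prod_list (proj10_words t) = 0" for t
  proof -
    have keysN: "Poly_Mapping.keys (proj10_words t) \<subseteq> words (bigraded G J 1 0) 2"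
      unfolding proj10_words_def using t
      by (rule keys_frag_extend_words) (simp add: words_2 proj10_bigraded)
    have "words (bigraded G J 1 0) 2 \<subseteq> words (Form G 1) 2"
      by (auto simp: words_def bigraded_10)
    then have keysF: "Poly_Mapping.keys (proj10_words t) \<subseteq> words (Form G 1) 2"
      using keysN by blast
    have "?N (proj10_words t) \<in> carrier (form_tensor G (bigraded G J 1 0) 2)"
      using keysN by (auto simp: form_tensor_def carrier_tensor_power_iff)
    moreover have "wedge G (?N (proj10_words t)) = 0"
      using 0 by (simp add: wedge_class[OF N])
    moreover have "form_tensor_incl G 2 (?N (proj10_words t)) = ?T (proj10_words t)"
      unfolding form_tensor_incl_def
      by (rule tensor_module.tensor_incl_class[OF tensor_module_Form N]) (auto simp: bigraded_10)
    ultimately have "pairing s (proj10_words t) = 0"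
      using assms(5) incl_x ev2_class[OF s keysF] by metis
    then show ?thesis
      by (simp add: pairing_proj10_words[OF s10 t])
  qed
  have J0: "J_form G J 2 0 = 0"
    using J_form_2_scale[of 0 0] Form_0 by simp
  \<comment> \<open>For \<omega> = 0 the polynomial in \<open>word_sum_proj10_words\<close>
    vanishes, so the projection preserves the kernel of the wedge map.\<close>
  have anti: "kills_ker_wedge s"
    using key word_sum_proj10_words by (simp add: kills_ker_wedge_def J0)
  note phi = phi_class[OF s anti]
  have \<phi>_Vec: "phi G (?S s) \<in> Vec G"
    using phi_class_Vec[OF s anti] .
  have vanish: "phi G (?S s) \<eta> = 0" if \<eta>: "\<eta> \<in> bigraded G J 0 1" for \<eta>
  proof -
    obtain \<alpha> \<beta> where der: "der G \<eta> = \<alpha> + \<beta>" and "\<alpha> \<in> bigraded G J 0 2" "\<beta> \<in> bigraded G J 1 1"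
      using assms(3) \<eta> unfolding integrable_structure_def by blast
    then have \<alpha>: "\<alpha> \<in> Form G 2" "J_form G J 2 \<alpha> = scaleC G (- 2 * \<i>) \<alpha>"
      and \<beta>: "\<beta> \<in> Form G 2" "J_form G J 2 \<beta> = 0"
      by (simp_all add: bigraded_02 bigraded_11)
    have J: "J_form G J 2 (\<alpha> + \<beta>) = scaleC G (- 2 * \<i>) \<alpha>"
      using J_form_2_add[OF \<alpha>(1) \<beta>(1)] \<alpha>(2) \<beta>(2) by simp
    have "- 2 * \<i> * (- 2 * \<i>) = - 4"
      by (simp add: complex_eq_iff)
    then have JJ: "J_form G J 2 (J_form G J 2 (\<alpha> + \<beta>)) = scaleC G (- 4) \<alpha>"
      unfolding J J_form_2_scale[OF \<alpha>(1)] \<alpha>(2) by (simp only: vs.scale_scale)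
    obtain t where t: "Poly_Mapping.keys t \<subseteq> words (Form G 1) 2" "word_sum G prod_list t = \<alpha> + \<beta>"
      using wedge_surj Form_add[OF \<alpha>(1) \<beta>(1)] by blast
    \<comment> \<open>The polynomial iK + K^2/2 vanishes at the eigenvalues -2i of \<alpha> and 0 of
      \<beta>: at -2i its two terms are 2 and -2. Hence the projection of a lift of d\<eta> wedges
      to zero.\<close>
    have "\<i> * (- 2 * \<i>) = 2" "1 / 2 * - 4 = (- 2 :: complex)"
      by (simp_all add: complex_eq_iff)
    then have "scaleC G \<i> (scaleC G (- 2 * \<i>) \<alpha>) + scaleC G (1 / 2) (scaleC G (- 4) \<alpha>) = 0"
      unfolding vs.scale_scale using vs.scale_left_distrib[of 2 "- 2" \<alpha>] by simp
    then have "word_sum G prod_list (proj10_words t) = 0"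
      unfolding word_sum_proj10_words[OF t] JJ unfolding J by simp
    then have "pairing s t = 0"
      by (rule key[OF t(1)])
    then show ?thesis
      using phi[of \<eta> t] \<eta> t der der_term_01[OF s10 \<eta>] by (simp add: bigraded_01)
  qed
  have "phi G (?S s) (J \<xi>) = scaleC G \<i> (phi G (?S s) \<xi>)" if \<xi>: "\<xi> \<in> Form G 1" for \<xi>
  proof -
    \<comment> \<open>Twice the (0,1)-part of \<xi>. That \<open>phi\<close> vanishes on it,
      multiplied by i, is the eigenvalue equation at \<xi>.\<close>
    define \<eta> where "\<eta> = \<xi> + scaleC G \<i> (J \<xi>)"
    have "\<eta> \<in> bigraded G J 0 1"
      unfolding \<eta>_def bigraded_01 using \<xi>
      by (simp add: Form_add Form_scale J_Form J_add J_scale J_J vs.scale_right_distrib)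
    then have "phi G (?S s) \<xi> + scaleC G \<i> (phi G (?S s) (J \<xi>)) = 0"
      using vanish[of \<eta>] \<xi>
      by (simp add: \<eta>_def Vec_add[OF \<phi>_Vec] Vec_scale[OF \<phi>_Vec] Form_scale J_Form)
    then have "scaleC G \<i> (phi G (?S s) \<xi> + scaleC G \<i> (phi G (?S s) (J \<xi>))) = 0"
      by simp
    then show ?thesis
      by (simp add: vs.scale_right_distrib)
  qed
  then show ?thesis
    unfolding incl_x Vec10_iff using \<phi>_Vec by blast
qed

end
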